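(* Let $T$ be an ergodic $\mathbb{R}^2$-action or an ergodic $\mathbb{Z}^2$-action. Then the set of $1$-dimensional linear subspaces $L\subseteq\mathbb{R}^2$ such that $T$ is not ergodic in the direction $L$ is at most countable. Similarly, if $T$ is weak mixing, then the set of $1$-dimensional linear subspaces $L\subseteq\mathbb{R}^2$ such that $T$ is not weak mixing in the direction $L$ is at most countable.
   Context: All actions are free measurable measure preserving actions on a Lebesgue probability space $(X,\mu)$. An action is ergodic (weak mixing) if the only invariant $L^2$ functions ($L^2$ eigenfunctions) are constants. For an $\mathbb{R}^2$-action $T$ and a nonzero subspace $L\subseteq\mathbb{R}^2$, $T$ is ergodic (weak mixing) in the direction $L$ if the $L$-action $\{T^{\vec t}\}_{\vec t\in L}$ is ergodic (weak mixing). For a $\mathbb{Z}^2$-action $T$, let $\widetilde T$ be the unit suspension: the $\mathbb{R}^2$-action on $(\widetilde X,\tilde\mu)=(X\times[0,1)^2,\mu\times\lambda)$, $\lambda$ Lebesgue measure, given by $\widetilde T^{\vec t}(x,\vec r)=(T^{\lfloor\vec t+\vec r\rfloor}x,\{\vec t+\vec r\})$, with componentwise integer part $\lfloor\cdot\rfloor$ and fractional part $\{\cdot\}$. Let $\mathcal{O}=\{F(x,\vec s)=f(\vec s): f\in L^2([0,1)^2,\lambda)\}$ and $L^2_{\mathcal{O}}(\widetilde X,\tilde\mu)=\mathcal{O}^\perp\subseteq L^2(\widetilde X,\tilde\mu)$. A nonzero $F\in L^2(\widetilde X,\tilde\mu)$ is a direction $L$ eigenfunction of $\widetilde T$ if for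 some $\vec\ell\in L$, $F(\widetilde T^{\vec t}y)=e^{2\pi i\vec\ell\cdot\vec t}F(y)$ for all $\vec t\in L$ and a.e. $y$, and direction $L$ invariant if this holds with $\vec\ell=\vec 0$. $T$ is ergodic (weak mixing) in the direction $L$ if $\widetilde T$ has no nonzero direction $L$ invariant function (direction $L$ eigenfunction) in $L^2_{\mathcal{O}}(\widetilde X,\tilde\mu)$. *)

theory Defs
  imports "HOL-Probability.Probability"
begin

definition isomorphic_mod_0 :: "'a measure \<Rightarrow> 'b measure \<Rightarrow> bool" where
  "isomorphic_mod_0 M N \<longleftrightarrow>
     (\<exists>A\<in>null_sets M. \<exists>B\<in>null_sets N. \<exists>f g.
        f \<in> restrict_space M (space M - A) \<rightarrow>\<^sub>M restrict_space N (space N - B) \<and>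
        g \<in> restrict_space N (space N - B) \<rightarrow>\<^sub>M restrict_space M (space M - A) \<and>
        (\<forall>x\<in>space M - A. g (f x) = x) \<and>
        (\<forall>y\<in>space N - B. f (g y) = y) \<and>
        distr (restrict_space M (space M - A)) (restrict_space N (space N - B)) f =
          restrict_space N (space N - B))"

text \<open>Rokhlin's convention: a complete probability space isomorphic mod 0 to the completion of
  a Borel probability measure on the line. Atoms are not excluded here; for the free actions
  below they cannot occur.\<close>

definition lebesgue_probability_space :: "'a measure \<Rightarrow> bool" where
  "lebesgue_probability_space M \<longleftrightarrow>
     prob_space M \<and> complete_measure M \<and>
     (\<exists>N :: real measure. prob_space N \<and> sets N = sets borel \<and>
        isomorphic_mod_0 M (completion N))"

text \<open>The group carries a reference measure \<open>G\<close>: \<open>lborel\<close> for the plane, counting measure for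
  the integer lattice. Since \<open>M\<close> is complete, joint measurability has to be taken with respect
  to the completed product: already for translations of a torus, the preimage of a null set
  under \<open>(t, x) \<mapsto> x + t\<close> need not belong to the uncompleted product sigma-algebra.\<close>

definition free_mp_action ::
    "'a measure \<Rightarrow> 'g::ab_group_add measure \<Rightarrow> ('g \<Rightarrow> 'a \<Rightarrow> 'a) \<Rightarrow> bool" where
  "free_mp_action M G T \<longleftrightarrow>
     lebesgue_probability_space M \<and>
     (\<lambda>(t, x). T t x) \<in> completion (G \<Otimes>\<^sub>M M) \<rightarrow>\<^sub>M M \<and>
     (\<forall>t. T t \<in> M \<rightarrow>\<^sub>M M \<and> distr M M (T t) = M) \<and>
     (\<forall>x\<in>space M. T 0 x = x) \<and>
     (\<forall>s t. \<forall>x\<in>space M. T (s + t) x = T s (T t x)) \<and>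
     (AE x in M. \<forall>t. t \<noteq> 0 \<longrightarrow> T t x \<noteq> x)"

abbreviation R2_action :: "'a measure \<Rightarrow> (real^2 \<Rightarrow> 'a \<Rightarrow> 'a) \<Rightarrow> bool" where
  "R2_action M T \<equiv> free_mp_action M lborel T"

abbreviation Z2_action :: "'a measure \<Rightarrow> (int^2 \<Rightarrow> 'a \<Rightarrow> 'a) \<Rightarrow> bool" where
  "Z2_action M T \<equiv> free_mp_action M (count_space UNIV) T"

definition L2 :: "'a measure \<Rightarrow> ('a \<Rightarrow> complex) set" where
  "L2 M = {F. F \<in> borel_measurable M \<and> integrable M (\<lambda>x. (cmod (F x))\<^sup>2)}"

text \<open>Elements of \<open>L2 M\<close> are functions, not classes, so identities hold almost everywhere,
  with an exceptional set that may depend on the group element. \<open>K\<close> is the acting subgroup.\<close>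

definition invariant_function ::
    "'a measure \<Rightarrow> ('g \<Rightarrow> 'a \<Rightarrow> 'a) \<Rightarrow> 'g set \<Rightarrow> ('a \<Rightarrow> complex) \<Rightarrow> bool" where
  "invariant_function M T K F \<longleftrightarrow> F \<in> L2 M \<and> (\<forall>t\<in>K. AE x in M. F (T t x) = F x)"

definition eigenfunction ::
    "'a measure \<Rightarrow> ('g \<Rightarrow> 'a \<Rightarrow> 'a) \<Rightarrow> 'g set \<Rightarrow> ('g \<Rightarrow> complex) \<Rightarrow> ('a \<Rightarrow> complex) \<Rightarrow> bool" where
  "eigenfunction M T K e F \<longleftrightarrow>
     F \<in> L2 M \<and> \<not> (AE x in M. F x = 0) \<and> (\<forall>t\<in>K. AE x in M. F (T t x) = e t * F x)"

definition character_R2 :: "real^2 \<Rightarrow> real^2 \<Rightarrow> complex" where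
  "character_R2 l t = cis (2 * pi * (l \<bullet> t))"

definition character_Z2 :: "real^2 \<Rightarrow> int^2 \<Rightarrow> complex" where
  "character_Z2 l n = character_R2 l (\<chi> i. of_int (n $ i))"

definition ergodic_on :: "'a measure \<Rightarrow> ('g \<Rightarrow> 'a \<Rightarrow> 'a) \<Rightarrow> 'g set \<Rightarrow> bool" where
  "ergodic_on M T K \<longleftrightarrow>
     (\<forall>F. invariant_function M T K F \<longrightarrow> (\<exists>c. AE x in M. F x = c))"

definition weak_mixing_on ::
    "'a measure \<Rightarrow> ('g \<Rightarrow> 'a \<Rightarrow> 'a) \<Rightarrow> 'g set \<Rightarrow> ('g \<Rightarrow> complex) set \<Rightarrow> bool" where
  "weak_mixing_on M T K C \<longleftrightarrow>
     (\<forall>e\<in>C. \<forall>F. eigenfunction M T K e F \<longrightarrow> (\<exists>c. AE x in M. F x = c))"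

definition ergodic :: "'a measure \<Rightarrow> ('g \<Rightarrow> 'a \<Rightarrow> 'a) \<Rightarrow> bool" where
  "ergodic M T \<longleftrightarrow> ergodic_on M T UNIV"

definition weak_mixing_R2 :: "'a measure \<Rightarrow> (real^2 \<Rightarrow> 'a \<Rightarrow> 'a) \<Rightarrow> bool" where
  "weak_mixing_R2 M T \<longleftrightarrow> weak_mixing_on M T UNIV (range character_R2)"

definition weak_mixing_Z2 :: "'a measure \<Rightarrow> (int^2 \<Rightarrow> 'a \<Rightarrow> 'a) \<Rightarrow> bool" where
  "weak_mixing_Z2 M T \<longleftrightarrow> weak_mixing_on M T UNIV (range character_Z2)"

definition ergodic_dir_R2 ::
    "'a measure \<Rightarrow> (real^2 \<Rightarrow> 'a \<Rightarrow> 'a) \<Rightarrow> (real^2) set \<Rightarrow> bool" where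
  "ergodic_dir_R2 M T L \<longleftrightarrow> ergodic_on M T L"

definition weak_mixing_dir_R2 ::
    "'a measure \<Rightarrow> (real^2 \<Rightarrow> 'a \<Rightarrow> 'a) \<Rightarrow> (real^2) set \<Rightarrow> bool" where
  "weak_mixing_dir_R2 M T L \<longleftrightarrow> weak_mixing_on M T L (character_R2 ` L)"

definition unit_square :: "(real^2) set" where
  "unit_square = {r. \<forall>i. 0 \<le> r $ i \<and> r $ i < 1}"

definition unit_square_measure :: "(real^2) measure" where
  "unit_square_measure = restrict_space lborel unit_square"

definition suspension_measure :: "'a measure \<Rightarrow> ('a \<times> (real^2)) measure" where
  "suspension_measure M = completion (M \<Otimes>\<^sub>M unit_square_measure)"

definition suspension :: "(int^2 \<Rightarrow> 'a \<Rightarrow> 'a) \<Rightarrow> real^2 \<Rightarrow> 'a \<times> (real^2) \<Rightarrow> 'a \<times> (real^2)" where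
  "suspension T t = (\<lambda>(x, r). (T (\<chi> i. \<lfloor>(t + r) $ i\<rfloor>) x, \<chi> i. frac ((t + r) $ i)))"

definition square_functions :: "('a \<times> (real^2) \<Rightarrow> complex) set" where
  "square_functions = {\<lambda>(x, s). f s | f. f \<in> L2 unit_square_measure}"

definition L2_perp_square :: "'a measure \<Rightarrow> ('a \<times> (real^2) \<Rightarrow> complex) set" where
  "L2_perp_square M =
     {F \<in> L2 (suspension_measure M).
        \<forall>H\<in>square_functions. (LINT y|suspension_measure M. F y * cnj (H y)) = 0}"

definition ergodic_dir_Z2 ::
    "'a measure \<Rightarrow> (int^2 \<Rightarrow> 'a \<Rightarrow> 'a) \<Rightarrow> (real^2) set \<Rightarrow> bool" where
  "ergodic_dir_Z2 M T L \<longleftrightarrow>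
     \<not> (\<exists>F\<in>L2_perp_square M. \<not> (AE y in suspension_measure M. F y = 0) \<and>
          invariant_function (suspension_measure M) (suspension T) L F)"

definition weak_mixing_dir_Z2 ::
    "'a measure \<Rightarrow> (int^2 \<Rightarrow> 'a \<Rightarrow> 'a) \<Rightarrow> (real^2) set \<Rightarrow> bool" where
  "weak_mixing_dir_Z2 M T L \<longleftrightarrow>
     \<not> (\<exists>F\<in>L2_perp_square M. \<exists>l\<in>L.
          eigenfunction (suspension_measure M) (suspension T) L (character_R2 l) F)"

definition lines :: "(real^2) set set" where
  "lines = {L. subspace L \<and> dim L = 1}"

end

theory Submission
  imports Defs
begin

text \<open>The idea is that directions in which the action fails to be ergodic (or weak mixing) produce pairwise
orthogonal functions, of which a separable \<open>L2\<close> space contains only countably many.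

Let \<open>F\<close> be an eigenfunction along a line \<open>L\<close> and \<open>F'\<close> one along a different line \<open>L'\<close>, both in a
fixed closed subspace \<open>V\<close> that is invariant under the action: the functions of mean zero for an
action of the plane, the complement of the functions of the square coordinate for a suspension. The
orthogonal projection of \<open>F\<close> to the space of eigenfunctions along \<open>L'\<close> with the frequency of \<open>F'\<close> is
still an eigenfunction along \<open>L\<close>, because the two lines act by commuting operators. As \<open>L\<close> and \<open>L'\<close>
span the plane, the projection is an eigenfunction of the whole action, and it lies in \<open>V\<close>; the
assumption on the action makes it zero. Hence \<open>F\<close> and \<open>F'\<close> are orthogonal
(\<open>eigenfunctions_orthogonal\<close>).

The projection is obtained as an element of minimal norm. Take the convex closed set of all
\<open>L\<close>-eigenfunctions in \<open>V\<close>, with the frequency of \<open>F\<close>, whose inner product with \<open>F'\<close> is that of \<open>F\<close>.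
The unitary operators \<open>cnj (e t) * (H \<circ> T t)\<close> for \<open>t \<in> L'\<close>, where \<open>e\<close> is the character of \<open>F'\<close>, map this
set to itself, so they fix its unique element of minimal norm (\<open>minimal_norm_element\<close>).

Separability enters through a countable family of measurable sets such that an integrable function
with vanishing integrals over these sets is zero almost everywhere. Such families exist on Borel
spaces and pass to completions, subspaces, isomorphic spaces and products
(\<open>lebesgue_probability_space_separating\<close>, \<open>separating_pair\<close>). By Bessel's inequality each set of
the family is non-orthogonal to only countably many members of an orthogonal system
(\<open>countable_orthogonal_family\<close>).

For a suspension it remains to see that \<open>V\<close> contains no eigenfunction of the whole plane. Such a
function is a character of the square coordinate times an eigenfunction of the lattice action
(\<open>suspension_eigenfunction_product\<close>); the latter is constant by assumption, so the function depends
on the square coordinate only and is orthogonal to itself (\<open>suspension_joint_eigenfunction_zero\<close>).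

Ergodicity and weak mixing are treated together: both say that eigenfunctions are constant, with
frequencies restricted to a set \<open>\<Lambda>\<close> that is \<open>{0}\<close> in the first case and the plane in the second.\<close>

section \<open>The space of square integrable functions\<close>

definition L2_inner :: "'a measure \<Rightarrow> ('a \<Rightarrow> complex) \<Rightarrow> ('a \<Rightarrow> complex) \<Rightarrow> complex" where
  "L2_inner N F H = (LINT y|N. F y * cnj (H y))"

definition L2_norm_sq :: "'a measure \<Rightarrow> ('a \<Rightarrow> complex) \<Rightarrow> real" where
  "L2_norm_sq N F = (LINT y|N. (cmod (F y))\<^sup>2)"

lemma L2_measurable: "F \<in> L2 N \<Longrightarrow> F \<in> borel_measurable N"
  and L2_integrable_square: "F \<in> L2 N \<Longrightarrow> integrable N (\<lambda>x. (cmod (F x))\<^sup>2)"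
  by (auto simp: L2_def)

lemma L2_mult_integrable:
  assumes "F \<in> L2 N" "H \<in> L2 N"
  shows "integrable N (\<lambda>x. F x * H x)"
proof (rule Bochner_Integration.integrable_bound)
  show "integrable N (\<lambda>x. (cmod (F x))\<^sup>2 + (cmod (H x))\<^sup>2)"
    using assms by (auto simp: L2_def)
  show "(\<lambda>x. F x * H x) \<in> borel_measurable N"
    using assms by (auto simp: L2_def)
  show "AE x in N. norm (F x * H x) \<le> norm ((cmod (F x))\<^sup>2 + (cmod (H x))\<^sup>2)"
  proof (rule AE_I2)
    fix x
    have "2 * (cmod (F x) * cmod (H x)) \<le> (cmod (F x))\<^sup>2 + (cmod (H x))\<^sup>2"
      using sum_squares_bound[of "cmod (F x)" "cmod (H x)"] by (simp add: mult_ac)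
    then have "norm (F x * H x) \<le> (cmod (F x))\<^sup>2 + (cmod (H x))\<^sup>2"
      using norm_ge_zero[of "F x * H x"] unfolding norm_mult by linarith
    then show "norm (F x * H x) \<le> norm ((cmod (F x))\<^sup>2 + (cmod (H x))\<^sup>2)"
      by simp
  qed
qed

lemma L2_cnj: "F \<in> L2 N \<Longrightarrow> (\<lambda>x. cnj (F x)) \<in> L2 N"
  by (auto simp: L2_def intro!: borel_measurable_continuous_on[OF continuous_on_cnj[OF continuous_on_id]])

lemma L2_inner_integrable:
  assumes "F \<in> L2 N" "H \<in> L2 N"
  shows "integrable N (\<lambda>x. F x * cnj (H x))"
  using L2_mult_integrable[OF assms(1) L2_cnj[OF assms(2)]] .

lemma L2_scale: "F \<in> L2 N \<Longrightarrow> (\<lambda>x. c * F x) \<in> L2 N"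
  by (auto simp: L2_def norm_mult power_mult_distrib)

lemma L2_add:
  assumes "F \<in> L2 N" "H \<in> L2 N" shows "(\<lambda>x. F x + H x) \<in> L2 N"
  unfolding L2_def
proof (intro CollectI conjI)
  show "(\<lambda>x. F x + H x) \<in> borel_measurable N" using assms by (auto simp: L2_def)
  show "integrable N (\<lambda>x. (cmod (F x + H x))\<^sup>2)"
  proof (rule Bochner_Integration.integrable_bound)
    show "integrable N (\<lambda>x. 2 * (cmod (F x))\<^sup>2 + 2 * (cmod (H x))\<^sup>2)"
      using assms by (auto simp: L2_def)
    show "(\<lambda>x. (cmod (F x + H x))\<^sup>2) \<in> borel_measurable N" using assms by (auto simp: L2_def)
    show "AE x in N. norm ((cmod (F x + H x))\<^sup>2) \<le> norm (2 * (cmod (F x))\<^sup>2 + 2 * (cmod (H x))\<^sup>2)"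
    proof (rule AE_I2)
      fix x
      have "(cmod (F x + H x))\<^sup>2 \<le> (cmod (F x) + cmod (H x))\<^sup>2"
        by (intro power_mono norm_triangle_ineq) auto
      also have "\<dots> \<le> 2 * (cmod (F x))\<^sup>2 + 2 * (cmod (H x))\<^sup>2"
        using sum_squares_bound[of "cmod (F x)" "cmod (H x)"] by (simp add: power2_sum)
      finally show "norm ((cmod (F x + H x))\<^sup>2) \<le> norm (2 * (cmod (F x))\<^sup>2 + 2 * (cmod (H x))\<^sup>2)"
        by simp
    qed
  qed
qed

lemma L2_diff:
  assumes "F \<in> L2 N" "H \<in> L2 N" shows "(\<lambda>x. F x - H x) \<in> L2 N"
  using L2_add[OF assms(1) L2_scale[OF assms(2), of "-1"]] by simp

lemma L2_bounded:
  assumes "finite_measure N" "F \<in> borel_measurable N" "\<And>x. x \<in> space N \<Longrightarrow> cmod (F x) \<le> B"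
  shows "F \<in> L2 N"
  unfolding L2_def
proof (intro CollectI conjI assms(2))
  interpret finite_measure N by fact
  show "integrable N (\<lambda>x. (cmod (F x))\<^sup>2)"
    by (rule integrable_const_bound[where B = "B\<^sup>2"]) (use assms in \<open>auto intro!: AE_I2 power_mono\<close>)
qed

lemma L2_integrable:
  assumes "finite_measure N" "F \<in> L2 N"
  shows "integrable N F"
proof -
  have "(\<lambda>_. 1) \<in> L2 N" by (rule L2_bounded[OF assms(1), where B = 1]) auto
  from L2_mult_integrable[OF assms(2) this] show ?thesis by simp
qed

lemma L2_cong_AE:
  assumes "F \<in> L2 N" "AE x in N. F x = H x" "H \<in> borel_measurable N"
  shows "H \<in> L2 N"
  unfolding L2_def
proof (intro CollectI conjI assms(3))
  have "integrable N (\<lambda>x. (cmod (F x))\<^sup>2)" using assms(1) by (simp add: L2_def)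
  then show "integrable N (\<lambda>x. (cmod (H x))\<^sup>2)"
    by (rule integrable_cong_AE_imp) (use assms in auto)
qed

lemma L2_inner_cong_AE:
  assumes "AE x in N. F x = F' x" "F \<in> L2 N" "F' \<in> L2 N" "H \<in> L2 N"
  shows "L2_inner N F H = L2_inner N F' H"
  unfolding L2_inner_def using assms L2_inner_integrable[OF assms(2,4)] L2_inner_integrable[OF assms(3,4)]
  by (intro integral_cong_AE) auto

lemma L2_norm_sq_nonneg: "0 \<le> L2_norm_sq N F"
  unfolding L2_norm_sq_def by simp

lemma L2_inner_self: "L2_inner N F F = of_real (L2_norm_sq N F)"
  unfolding L2_inner_def L2_norm_sq_def complex_norm_square[symmetric] by (rule integral_complex_of_real)

lemma L2_norm_sq_eq_0_iff: "F \<in> L2 N \<Longrightarrow> L2_norm_sq N F = 0 \<longleftrightarrow> (AE x in N. F x = 0)"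
  unfolding L2_norm_sq_def by (subst integral_nonneg_eq_0_iff_AE) (auto simp: L2_def)

lemma L2_inner_diff_left:
  assumes "F \<in> L2 N" "G \<in> L2 N" "H \<in> L2 N"
  shows "L2_inner N (\<lambda>x. F x - G x) H = L2_inner N F H - L2_inner N G H"
  unfolding L2_inner_def using L2_inner_integrable[OF assms(1,3)] L2_inner_integrable[OF assms(2,3)]
  by (simp add: left_diff_distrib)

lemma L2_inner_add_left:
  assumes "F \<in> L2 N" "G \<in> L2 N" "H \<in> L2 N"
  shows "L2_inner N (\<lambda>x. F x + G x) H = L2_inner N F H + L2_inner N G H"
  unfolding L2_inner_def using L2_inner_integrable[OF assms(1,3)] L2_inner_integrable[OF assms(2,3)]
  by (simp add: distrib_right)

lemma L2_inner_scale_left: "L2_inner N (\<lambda>x. c * F x) H = c * L2_inner N F H"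
  unfolding L2_inner_def by (simp add: mult.assoc)

lemma L2_inner_commute: "L2_inner N H F = cnj (L2_inner N F H)"
  unfolding L2_inner_def by (subst Bochner_Integration.integral_cnj[symmetric]) (simp add: mult.commute)

lemma L2_norm_sq_scale: "L2_norm_sq N (\<lambda>x. c * F x) = (cmod c)\<^sup>2 * L2_norm_sq N F"
  unfolding L2_norm_sq_def by (simp add: norm_mult power_mult_distrib)

text \<open>Pythagoras for the component of \<open>H\<close> orthogonal to \<open>F\<close>. The Cauchy--Schwarz inequality and Bessel's
inequality are both read off from it.\<close>

lemma L2_norm_sq_subtract_projection:
  assumes "F \<in> L2 N" "H \<in> L2 N" "L2_norm_sq N F \<noteq> 0"
  defines "c \<equiv> L2_inner N H F / of_real (L2_norm_sq N F)"
  shows "L2_norm_sq N (\<lambda>x. H x - c * F x) = L2_norm_sq N H - (cmod (L2_inner N H F))\<^sup>2 / L2_norm_sq N F"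
proof -
  let ?D = "\<lambda>x. H x - c * F x"
  have cF: "(\<lambda>x. c * F x) \<in> L2 N" and D: "?D \<in> L2 N"
    by (rule L2_scale, fact assms, intro L2_diff L2_scale assms)
  have DF: "L2_inner N ?D F = 0"
    unfolding L2_inner_diff_left[OF assms(2) cF assms(1)] L2_inner_scale_left L2_inner_self
    using assms(3) by (simp add: c_def)
  have "of_real (L2_norm_sq N ?D) = L2_inner N ?D ?D" by (simp add: L2_inner_self)
  also have "\<dots> = cnj (L2_inner N H ?D - c * L2_inner N F ?D)"
    using L2_inner_diff_left[OF assms(2) cF D] by (subst L2_inner_commute) (simp add: L2_inner_scale_left)
  also have "L2_inner N F ?D = 0" using DF by (subst L2_inner_commute) simp
  also have "cnj (L2_inner N H ?D - c * 0) = L2_inner N ?D H" by (simp add: L2_inner_commute[symmetric])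
  also have "\<dots> = L2_inner N H H - c * L2_inner N F H"
    by (simp add: L2_inner_diff_left[OF assms(2) cF assms(2)] L2_inner_scale_left)
  also have "\<dots> = of_real (L2_norm_sq N H) - L2_inner N H F * cnj (L2_inner N H F) / of_real (L2_norm_sq N F)"
    by (simp add: L2_inner_self c_def L2_inner_commute[symmetric])
  also have "\<dots> = of_real (L2_norm_sq N H - (cmod (L2_inner N H F))\<^sup>2 / L2_norm_sq N F)"
    by (simp add: complex_norm_square[symmetric])
  finally show ?thesis unfolding of_real_eq_iff .
qed

lemma L2_inner_Cauchy_Schwarz:
  assumes "F \<in> L2 N" "H \<in> L2 N"
  shows "(cmod (L2_inner N H F))\<^sup>2 \<le> L2_norm_sq N H * L2_norm_sq N F"
proof (cases "L2_norm_sq N F = 0")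
  case True
  then have "AE x in N. F x = 0" using assms L2_norm_sq_eq_0_iff by blast
  then have "L2_inner N H F = (LINT x|N. 0)"
    unfolding L2_inner_def using L2_inner_integrable[OF assms(2,1)]
    by (intro integral_cong_AE) auto
  then show ?thesis using True by simp
next
  case False
  then have "0 < L2_norm_sq N F" using L2_norm_sq_nonneg[of N F] by simp
  moreover have "0 \<le> L2_norm_sq N H - (cmod (L2_inner N H F))\<^sup>2 / L2_norm_sq N F"
    using L2_norm_sq_subtract_projection[OF assms False] L2_norm_sq_nonneg by metis
  ultimately show ?thesis by (simp add: field_simps)
qed

lemma L2_norm_L1_le:
  assumes "prob_space N" "F \<in> L2 N"
  shows "(LINT x|N. cmod (F x))\<^sup>2 \<le> L2_norm_sq N F"
proof -
  interpret prob_space N by fact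
  have 1: "(\<lambda>_. 1) \<in> L2 N" by (rule L2_bounded[where B = 1]) (auto intro: finite_measure_axioms)
  have A: "(\<lambda>x. of_real (cmod (F x))) \<in> L2 N" using assms(2) by (auto simp: L2_def)
  have "L2_inner N (\<lambda>x. of_real (cmod (F x))) (\<lambda>_. 1) = of_real (LINT x|N. cmod (F x))"
    by (simp add: L2_inner_def)
  with L2_inner_Cauchy_Schwarz[OF 1 A] show ?thesis
    by (simp add: L2_norm_sq_def prob_space)
qed

lemma parallelogram:
  assumes "F \<in> L2 N" "H \<in> L2 N"
  shows "L2_norm_sq N (\<lambda>x. F x - H x) + 4 * L2_norm_sq N (\<lambda>x. (F x + H x) / 2) = 2 * L2_norm_sq N F + 2 * L2_norm_sq N H"
proof -
  have p: "(cmod (a - b))\<^sup>2 + 4 * (cmod ((a + b) / 2))\<^sup>2 = 2 * (cmod a)\<^sup>2 + 2 * (cmod b)\<^sup>2" for a b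
    unfolding cmod_power2 by (simp add: power2_eq_square field_simps)
  have m: "(\<lambda>x. (F x + H x) / 2) \<in> L2 N"
    using L2_scale[OF L2_add[OF assms], of "1/2"] by simp
  note i = L2_integrable_square[OF assms(1)] L2_integrable_square[OF assms(2)]
    L2_integrable_square[OF L2_diff[OF assms]] L2_integrable_square[OF m]
  have "L2_norm_sq N (\<lambda>x. F x - H x) + 4 * L2_norm_sq N (\<lambda>x. (F x + H x) / 2)
    = (LINT x|N. (cmod (F x - H x))\<^sup>2 + 4 * (cmod ((F x + H x) / 2))\<^sup>2)"
    using i by (simp add: L2_norm_sq_def)
  also have "\<dots> = (LINT x|N. 2 * (cmod (F x))\<^sup>2 + 2 * (cmod (H x))\<^sup>2)"
    by (simp only: p)
  also have "\<dots> = 2 * L2_norm_sq N F + 2 * L2_norm_sq N H" using i by (simp add: L2_norm_sq_def)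
  finally show ?thesis .
qed

lemma L2_measure_preserving:
  assumes f [measurable]: "f \<in> M \<rightarrow>\<^sub>M N" and d: "distr M N f = N" and F: "F \<in> L2 N"
  shows "(\<lambda>x. F (f x)) \<in> L2 M"
  unfolding L2_def
proof (intro CollectI conjI)
  have [measurable]: "F \<in> borel_measurable N" using F by (rule L2_measurable)
  show "(\<lambda>x. F (f x)) \<in> borel_measurable M" by measurable
  have "integrable (distr M N f) (\<lambda>x. (cmod (F x))\<^sup>2)"
    using F by (simp add: d L2_def)
  then show "integrable M (\<lambda>x. (cmod (F (f x)))\<^sup>2)"
    by (subst (asm) integrable_distr_eq) auto
qed

lemma L2_completion: "F \<in> L2 N \<Longrightarrow> F \<in> L2 (completion N)"
  by (auto simp: L2_def measurable_completion integrable_completion)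

text \<open>Preimages of null sets are null, so the preimage of a set in the completion is again in the
completion.\<close>

lemma measure_preserving_completion:
  assumes f: "f \<in> P \<rightarrow>\<^sub>M P" and d: "distr P P f = P"
  shows "f \<in> completion P \<rightarrow>\<^sub>M completion P" "distr (completion P) (completion P) f = completion P"
proof -
  have fc: "f \<in> completion P \<rightarrow>\<^sub>M P" by (rule measurable_completion[OF f])
  have dc: "distr (completion P) P f = P" using distr_completion[OF f] d by simp
  show "f \<in> completion P \<rightarrow>\<^sub>M completion P"
    by (rule completion.measurable_completion2[OF fc]) (simp add: dc)
  show "distr (completion P) (completion P) f = completion P"
    using completion.completion_distr_eq[OF fc] by (simp add: dc)
qed

text \<open>The Cauchy--Schwarz inequality makes inner products continuous; linear constraints therefore define
closed sets.\<close>

lemma L2_inner_tendsto: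
  assumes f: "\<And>n. f n \<in> L2 N" and F: "F \<in> L2 N" and D: "D \<in> L2 N"
    and lim: "(\<lambda>n. L2_norm_sq N (\<lambda>x. F x - f n x)) \<longlonglongrightarrow> 0"
  shows "(\<lambda>n. L2_inner N (f n) D) \<longlonglongrightarrow> L2_inner N F D"
proof -
  have "(\<lambda>n. (cmod (L2_inner N F D - L2_inner N (f n) D))\<^sup>2) \<longlonglongrightarrow> 0"
  proof (rule tendsto_sandwich[OF _ _ tendsto_const])
    show "(\<lambda>n. L2_norm_sq N (\<lambda>x. F x - f n x) * L2_norm_sq N D) \<longlonglongrightarrow> 0"
      using tendsto_mult_right[OF lim, of "L2_norm_sq N D"] by simp
    show "\<forall>\<^sub>F n in sequentially. (cmod (L2_inner N F D - L2_inner N (f n) D))\<^sup>2 \<le> L2_norm_sq N (\<lambda>x. F x - f n x) * L2_norm_sq N D"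
      using L2_inner_Cauchy_Schwarz[OF D L2_diff[OF F f]] by (simp add: L2_inner_diff_left[OF F f D])
  qed simp
  then have "(\<lambda>n. cmod (L2_inner N F D - L2_inner N (f n) D)) \<longlonglongrightarrow> 0"
    using tendsto_real_sqrt by fastforce
  then have "(\<lambda>n. L2_inner N F D - L2_inner N (f n) D) \<longlonglongrightarrow> 0" by (rule tendsto_norm_zero_cancel)
  from tendsto_diff[OF tendsto_const[of "L2_inner N F D"] this] show ?thesis by simp
qed

section \<open>Elements of minimal norm\<close>

text \<open>The Hilbert space theorem on convex closed sets: by the parallelogram law a minimising sequence is a
Cauchy sequence, and two elements of minimal norm agree. Completeness of \<open>L2\<close> is proved along the
way. Since the limit is found both in norm and almost everywhere, closedness of \<open>K\<close> may be assumed
for sequences that converge in both senses, which makes it easy to verify for pointwise identities.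
Membership of midpoints is the only form of convexity that the parallelogram law asks for.\<close>

lemma minimal_norm_element:
  assumes N: "prob_space N" and K: "K \<subseteq> L2 N" "K \<noteq> {}"
    and mid: "\<And>F H. F \<in> K \<Longrightarrow> H \<in> K \<Longrightarrow> (\<lambda>x. (F x + H x) / 2) \<in> K"
    and closed: "\<And>f F. (\<And>n. f n \<in> K) \<Longrightarrow> F \<in> L2 N \<Longrightarrow> (\<lambda>n. L2_norm_sq N (\<lambda>x. F x - f n x)) \<longlonglongrightarrow> 0 \<Longrightarrow>
        (AE x in N. (\<lambda>n. f n x) \<longlonglongrightarrow> F x) \<Longrightarrow> F \<in> K"
  shows "\<exists>G\<in>K. \<forall>H\<in>K. L2_norm_sq N H \<le> L2_norm_sq N G \<longrightarrow> (AE x in N. H x = G x)"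
proof -
  interpret prob_space N by fact
  define m where "m = Inf (L2_norm_sq N ` K)"
  have bdd: "bdd_below (L2_norm_sq N ` K)" using L2_norm_sq_nonneg by (auto simp: bdd_below_def)
  have m_le: "m \<le> L2_norm_sq N F" if "F \<in> K" for F
    unfolding m_def using bdd that by (auto intro: cInf_lower)
  have close: "L2_norm_sq N (\<lambda>x. F x - H x) \<le> 2 * L2_norm_sq N F + 2 * L2_norm_sq N H - 4 * m"
    if "F \<in> K" "H \<in> K" for F H
  proof -
    have "F \<in> L2 N" "H \<in> L2 N" using that K(1) by auto
    from parallelogram[OF this] m_le[OF mid[OF that]] show ?thesis by (simp add: algebra_simps)
  qed
  \<comment> \<open>The excess over the minimum is chosen so small that consecutive terms differ by at most
    \<open>(1/2)^n\<close> in \<open>L1\<close>.\<close>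
  define e where "e n = (1/4 :: real) ^ n / 8" for n :: nat
  have e: "0 < e n" "e (Suc n) \<le> e n" for n by (auto simp: e_def)
  have e0: "e \<longlonglongrightarrow> 0"
  proof -
    have "(\<lambda>n. (1/4 :: real) ^ n) \<longlonglongrightarrow> 0" by (rule LIMSEQ_realpow_zero) auto
    from tendsto_divide[OF this tendsto_const[of 8]] show ?thesis by (simp add: e_def[abs_def])
  qed
  have dece: "e k \<le> e n" if "n \<le> k" for n k
    using that by (induction rule: dec_induct) (auto intro: order_trans[OF e(2)])
  have "\<exists>F\<in>K. L2_norm_sq N F < m + e n" for n
  proof -
    have "Inf (L2_norm_sq N ` K) < m + e n" using e(1)[of n] by (simp add: m_def)
    then show ?thesis using K(2) bdd by (subst (asm) cInf_less_iff) auto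
  qed
  then obtain f where fK: "\<And>n. f n \<in> K" and fm: "\<And>n. L2_norm_sq N (f n) < m + e n" by metis
  have fL: "f n \<in> L2 N" for n using fK K(1) by auto
  have [measurable]: "f n \<in> borel_measurable N" for n using fL by (auto simp: L2_def)
  have cauchy: "L2_norm_sq N (\<lambda>x. f k x - f n x) \<le> 4 * e n" if "n \<le> k" for n k
    using close[OF fK[of k] fK[of n]] fm[of n] fm[of k] dece[OF that] by linarith
  have inc: "(LINT x|N. cmod (f (Suc n) x - f n x)) \<le> (1/2)^n" for n
  proof -
    have "(LINT x|N. cmod (f (Suc n) x - f n x))\<^sup>2 \<le> L2_norm_sq N (\<lambda>x. f (Suc n) x - f n x)"
      by (rule L2_norm_L1_le[OF N L2_diff[OF fL fL]])
    also have "\<dots> \<le> 4 * e n" using cauchy[of n "Suc n"] by simp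
    also have "\<dots> \<le> (1/4)^n" by (simp add: e_def)
    also have "\<dots> = ((1/2)^n)\<^sup>2"
      unfolding power2_eq_square power_mult_distrib[symmetric] by simp
    finally show ?thesis by (rule power2_le_imp_le) auto
  qed
  have "AE x in N. summable (\<lambda>n. cmod (f (Suc n) x - f n x))"
  proof -
    have "(\<integral>\<^sup>+x. (\<Sum>n. ennreal (cmod (f (Suc n) x - f n x))) \<partial>N)
      = (\<Sum>n. \<integral>\<^sup>+x. ennreal (cmod (f (Suc n) x - f n x)) \<partial>N)"
      by (rule nn_integral_suminf) measurable
    also have "\<dots> \<le> (\<Sum>n. ennreal ((1/2)^n))"
    proof (intro suminf_le summableI)
      fix n
      have "integrable N (\<lambda>x. cmod (f (Suc n) x - f n x))"
        using L2_integrable[OF finite_measure_axioms L2_diff[OF fL fL]] by (rule integrable_norm)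
      then have "(\<integral>\<^sup>+x. ennreal (cmod (f (Suc n) x - f n x)) \<partial>N) = ennreal (LINT x|N. cmod (f (Suc n) x - f n x))"
        by (rule nn_integral_eq_integral) auto
      then show "(\<integral>\<^sup>+x. ennreal (cmod (f (Suc n) x - f n x)) \<partial>N) \<le> ennreal ((1/2)^n)"
        using inc[of n] by (simp add: ennreal_leI)
    qed
    also have "\<dots> = ennreal (\<Sum>n. (1/2)^n)"
      by (rule suminf_ennreal2) (auto intro: summable_geometric)
    also have "\<dots> < \<infinity>" by simp
    finally have "AE x in N. (\<Sum>n. ennreal (cmod (f (Suc n) x - f n x))) \<noteq> \<infinity>"
      by (intro nn_integral_PInf_AE) auto
    then show ?thesis
      by eventually_elim (rule summable_suminf_not_top, auto)
  qed
  then have conv: "AE x in N. convergent (\<lambda>n. f n x)"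
  proof eventually_elim
    case (elim x)
    then have "summable (\<lambda>n. f (Suc n) x - f n x)" by (rule summable_norm_cancel)
    then have "convergent (\<lambda>n. \<Sum>i<n. f (Suc i) x - f i x)"
      by (simp add: summable_iff_convergent)
    then have "convergent (\<lambda>n. f 0 x + (f n x - f 0 x))"
      by (intro convergent_add convergent_const) (simp add: sum_lessThan_telescope[of "\<lambda>n. f n x"])
    then show ?case by simp
  qed
  define G where "G x = lim (\<lambda>n. f n x)" for x
  have lim: "AE x in N. (\<lambda>n. f n x) \<longlonglongrightarrow> G x"
    using conv by eventually_elim (simp add: G_def convergent_LIMSEQ_iff)
  have [measurable]: "G \<in> borel_measurable N"
    unfolding G_def[abs_def] by (rule borel_measurable_lim_metric) measurable
  \<comment> \<open>Fatou's lemma turns bounds along the sequence into bounds for the limit. With \<open>h = f n\<close> it gives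
    convergence in norm, with \<open>h = 0\<close> minimality of the norm.\<close>
  have fatou: "(\<integral>\<^sup>+x. ennreal ((cmod (G x - h x))\<^sup>2) \<partial>N) \<le> ennreal c"
    if h: "h \<in> L2 N" and c: "\<forall>\<^sub>F k in sequentially. L2_norm_sq N (\<lambda>x. f k x - h x) \<le> c" for h c
  proof -
    have [measurable]: "h \<in> borel_measurable N" using h by (auto simp: L2_def)
    have "(\<integral>\<^sup>+x. ennreal ((cmod (G x - h x))\<^sup>2) \<partial>N)
      = (\<integral>\<^sup>+x. liminf (\<lambda>k. ennreal ((cmod (f k x - h x))\<^sup>2)) \<partial>N)"
    proof (rule nn_integral_cong_AE)
      show "AE x in N. ennreal ((cmod (G x - h x))\<^sup>2) = liminf (\<lambda>k. ennreal ((cmod (f k x - h x))\<^sup>2))"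
        using lim
      proof eventually_elim
        case (elim x)
        have "(\<lambda>k. ennreal ((cmod (f k x - h x))\<^sup>2)) \<longlonglongrightarrow> ennreal ((cmod (G x - h x))\<^sup>2)"
          by (intro tendsto_ennrealI tendsto_intros elim)
        from lim_imp_Liminf[OF _ this] show ?case by simp
      qed
    qed
    also have "\<dots> \<le> liminf (\<lambda>k. \<integral>\<^sup>+x. ennreal ((cmod (f k x - h x))\<^sup>2) \<partial>N)"
      by (rule nn_integral_liminf) measurable
    also have "\<dots> \<le> ennreal c"
    proof -
      have "(\<integral>\<^sup>+x. ennreal ((cmod (f k x - h x))\<^sup>2) \<partial>N) = ennreal (L2_norm_sq N (\<lambda>x. f k x - h x))" for k
        unfolding L2_norm_sq_def by (rule nn_integral_eq_integral[OF L2_integrable_square[OF L2_diff[OF fL h]]]) auto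
      then have "\<forall>\<^sub>F k in sequentially. (\<integral>\<^sup>+x. ennreal ((cmod (f k x - h x))\<^sup>2) \<partial>N) \<le> ennreal c"
        using c by (auto elim!: eventually_mono intro: ennreal_leI)
      then have "liminf (\<lambda>k. \<integral>\<^sup>+x. ennreal ((cmod (f k x - h x))\<^sup>2) \<partial>N) \<le> liminf (\<lambda>k. ennreal c)"
        by (rule Liminf_mono)
      then show ?thesis by (simp add: Liminf_const)
    qed
    finally show ?thesis .
  qed
  have L: "(\<lambda>x. G x - h x) \<in> L2 N \<and> L2_norm_sq N (\<lambda>x. G x - h x) \<le> c"
    if h: "h \<in> L2 N" and c: "0 \<le> c" "\<forall>\<^sub>F k in sequentially. L2_norm_sq N (\<lambda>x. f k x - h x) \<le> c" for h c
  proof -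
    have [measurable]: "h \<in> borel_measurable N" using h by (auto simp: L2_def)
    have "integrable N (\<lambda>x. (cmod (G x - h x))\<^sup>2)"
    proof (rule integrableI_bounded)
      show "(\<lambda>x. (cmod (G x - h x))\<^sup>2) \<in> borel_measurable N" by measurable
      show "(\<integral>\<^sup>+x. ennreal (norm ((cmod (G x - h x))\<^sup>2)) \<partial>N) < \<infinity>"
        using fatou[OF h c(2)] by (simp add: order_le_less_trans[OF _ ennreal_less_top])
    qed
    moreover from this have "ennreal (L2_norm_sq N (\<lambda>x. G x - h x)) \<le> ennreal c"
      unfolding L2_norm_sq_def using fatou[OF h c(2)] by (subst nn_integral_eq_integral[symmetric]) auto
    ultimately show ?thesis using c(1) by (simp add: L2_def)
  qed
  have Gf: "(\<lambda>x. G x - f n x) \<in> L2 N" "L2_norm_sq N (\<lambda>x. G x - f n x) \<le> 4 * e n" for n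
  proof -
    have "\<forall>\<^sub>F k in sequentially. L2_norm_sq N (\<lambda>x. f k x - f n x) \<le> 4 * e n"
      unfolding eventually_sequentially using cauchy by blast
    from L[OF fL _ this] e(1)[of n]
    show "(\<lambda>x. G x - f n x) \<in> L2 N" "L2_norm_sq N (\<lambda>x. G x - f n x) \<le> 4 * e n" by auto
  qed
  have GL: "G \<in> L2 N" using L2_add[OF Gf(1)[of 0] fL[of 0]] by simp
  have "(\<lambda>n. L2_norm_sq N (\<lambda>x. G x - f n x)) \<longlonglongrightarrow> 0"
  proof (rule tendsto_sandwich[OF _ _ tendsto_const])
    show "(\<lambda>n. 4 * e n) \<longlonglongrightarrow> 0" using tendsto_mult[OF tendsto_const[of 4] e0] by simp
  qed (simp_all add: Gf L2_norm_sq_nonneg)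
  then have GK: "G \<in> K" by (rule closed[OF fK GL _ lim])
  have "L2_norm_sq N G \<le> m + e n" for n
  proof -
    have z: "(\<lambda>_. 0) \<in> L2 N" by (rule L2_bounded[where B = 0]) (auto intro: finite_measure_axioms)
    have "0 \<le> m" unfolding m_def using K(2) L2_norm_sq_nonneg by (intro cInf_greatest) auto
    moreover have "\<forall>\<^sub>F k in sequentially. L2_norm_sq N (\<lambda>x. f k x - 0) \<le> m + e n"
      unfolding eventually_sequentially diff_0_right
    proof (intro exI allI impI)
      show "L2_norm_sq N (\<lambda>x. f k x) \<le> m + e n" if "n \<le> k" for k
        using fm[of k] dece[OF that] by linarith
    qed
    ultimately show ?thesis using L[OF z, of "m + e n"] e(1)[of n] by auto
  qed
  then have "L2_norm_sq N G \<le> m"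
    using tendsto_lowerbound[OF tendsto_add[OF tendsto_const[of m] e0], of "L2_norm_sq N G"] by simp
  show ?thesis
  proof (intro bexI[OF _ GK] ballI impI)
    fix H assume H: "H \<in> K" "L2_norm_sq N H \<le> L2_norm_sq N G"
    have "L2_norm_sq N (\<lambda>x. H x - G x) \<le> 0"
      using close[OF H(1) GK] H(2) \<open>L2_norm_sq N G \<le> m\<close> by linarith
    then have "L2_norm_sq N (\<lambda>x. H x - G x) = 0" using L2_norm_sq_nonneg[of N "\<lambda>x. H x - G x"] by linarith
    then show "AE x in N. H x = G x"
      using L2_norm_sq_eq_0_iff[OF L2_diff[of H N G]] H(1) GL K(1) by auto
  qed
qed

section \<open>Separating families and orthogonal systems\<close>

text \<open>A substitute for separability of \<open>L2\<close> that is stable under the constructions below: the indicator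
functions of the countable family are total.\<close>

definition separating :: "'a measure \<Rightarrow> 'a set set \<Rightarrow> bool" where
  "separating N C \<longleftrightarrow> countable C \<and> C \<subseteq> sets N \<and>
     (\<forall>F :: 'a \<Rightarrow> complex. integrable N F \<longrightarrow> (\<forall>A\<in>C. (LINT x:A|N. F x) = 0) \<longrightarrow> (AE x in N. F x = 0))"

text \<open>The sets over which \<open>F\<close> integrates to zero form a Dynkin system.\<close>

lemma integral_zero_sigma_sets:
  fixes F :: "'a \<Rightarrow> complex"
  assumes F: "integrable N F" and C: "Int_stable C" "C \<subseteq> Pow (space N)" "sets N = sigma_sets (space N) C"
    and zero: "\<And>A. A \<in> C \<Longrightarrow> (LINT x:A|N. F x) = 0" "(LINT x:space N|N. F x) = 0"
    and A: "A \<in> sets N"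
  shows "(LINT x:A|N. F x) = 0"
proof -
  have int: "set_integrable N A F" if "A \<in> sets N" for A
    unfolding set_integrable_def by (rule integrable_mult_indicator[OF that F])
  have A': "A \<in> sigma_sets (space N) C" using A C(3) by simp
  show ?thesis
  proof (rule sigma_sets_induct_disjoint[OF C(1,2) A'])
    show "(LINT x:A|N. F x) = 0" if "A \<in> C" for A by (rule zero(1)[OF that])
    show "(LINT x:{}|N. F x) = 0" by (simp add: set_lebesgue_integral_def)
  next
    fix A assume "A \<in> sigma_sets (space N) C" and 0: "(LINT x:A|N. F x) = 0"
    then have A: "A \<in> sets N" using C(3) by simp
    have "(LINT x:A \<union> (space N - A)|N. F x) = (LINT x:A|N. F x) + (LINT x:space N - A|N. F x)"
      using A by (intro set_integral_Un int) auto
    moreover have "A \<union> (space N - A) = space N" using sets.sets_into_space[OF A] by auto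
    ultimately show "(LINT x:space N - A|N. F x) = 0" using 0 zero(2) by simp
  next
    fix A :: "nat \<Rightarrow> 'a set"
    assume "disjoint_family A" and r: "range A \<subseteq> sigma_sets (space N) C" and 0: "\<And>i. (LINT x:A i|N. F x) = 0"
    have "A i \<in> sets N" for i using r C(3) by auto
    then show "(LINT x:(\<Union>i. A i)|N. F x) = 0"
      using lebesgue_integral_countable_add[of A N F] int \<open>disjoint_family A\<close> 0
      by (auto simp: disjoint_family_on_def)
  qed
qed

text \<open>Finite intersections of basic open sets form a countable generator of the Borel sets that is stable
under intersection.\<close>

lemma exists_separating_borel:
  "\<exists>C :: 'b :: second_countable_topology set set.
     \<forall>N. sigma_finite_measure N \<longrightarrow> sets N = sets borel \<longrightarrow> separating N C"
proof -
  obtain B :: "'b set set" where B: "countable B" "topological_basis B"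
    using ex_countable_basis by auto
  \<comment> \<open>The empty intersection contributes the whole space.\<close>
  define C where "C = Inter ` {F. finite F \<and> F \<subseteq> B}"
  have cC: "countable C" unfolding C_def
    using countable_Collect_finite_subset[OF B(1)] by (intro countable_image) (simp add: conj_commute)
  have st: "Int_stable C"
  proof (rule Int_stableI)
    fix a b assume "a \<in> C" "b \<in> C"
    then obtain F G where "a = \<Inter>F" "b = \<Inter>G" "finite F" "F \<subseteq> B" "finite G" "G \<subseteq> B" by (auto simp: C_def)
    then have "a \<inter> b = \<Inter>(F \<union> G)" "finite (F \<union> G)" "F \<union> G \<subseteq> B" by auto
    then show "a \<inter> b \<in> C" unfolding C_def by blast
  qed
  have UC: "UNIV \<in> C" unfolding C_def by (auto intro!: image_eqI[of _ _ "{}"])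
  have BC: "B \<subseteq> C" unfolding C_def by (auto intro!: image_eqI[of _ _ "{_}"])
  have open_C: "open a" if "a \<in> C" for a
    using that topological_basis_open[OF B(2)] unfolding C_def by (auto intro!: open_Inter)
  have gen: "sets borel = sigma_sets UNIV C"
  proof
    have "sets borel = sigma_sets UNIV B"
      by (subst borel_eq_countable_basis[OF B]) (simp add: sets_measure_of)
    then show "sets borel \<subseteq> sigma_sets UNIV C" using sigma_sets_mono'[OF BC, of UNIV] by simp
    have "C \<subseteq> sets borel" using open_C by auto
    then show "sigma_sets UNIV C \<subseteq> sets borel"
      using sets.sigma_sets_subset[of C borel] by simp
  qed
  show ?thesis
  proof (intro exI[of _ C] allI impI)
    fix N :: "'b measure" assume sf: "sigma_finite_measure N" and s: "sets N = sets borel"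
    have sp: "space N = UNIV" using sets_eq_imp_space_eq[OF s] by simp
    show "separating N C"
      unfolding separating_def
    proof (intro conjI allI impI cC)
      show "C \<subseteq> sets N" using open_C s by auto
      fix F :: "'b \<Rightarrow> complex" assume F: "integrable N F" and 0: "\<forall>A\<in>C. (LINT x:A|N. F x) = 0"
      show "AE x in N. F x = 0"
        by (rule sigma_finite_measure.density_zero[OF sf F], rule integral_zero_sigma_sets[OF F st])
          (use 0 UC gen s sp in auto)
    qed
  qed
qed

lemma separatingD:
  fixes F :: "'a \<Rightarrow> complex"
  assumes "separating N C" "integrable N F" "\<And>A. A \<in> C \<Longrightarrow> (LINT x:A|N. F x) = 0"
  shows "AE x in N. F x = 0"
  using assms unfolding separating_def by blast

lemma separating_sets: "separating N C \<Longrightarrow> A \<in> C \<Longrightarrow> A \<in> sets N"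
  and separating_countable: "separating N C \<Longrightarrow> countable C"
  unfolding separating_def by auto

lemma completion_ex_borel_measurable_complex:
  fixes F :: "'a \<Rightarrow> complex"
  assumes "F \<in> borel_measurable (completion N)"
  obtains G where "G \<in> borel_measurable N" "AE x in N. F x = G x"
proof -
  have "(\<lambda>x. Re (F x)) \<in> borel_measurable (completion N)" "(\<lambda>x. Im (F x)) \<in> borel_measurable (completion N)"
    using assms by measurable
  then obtain u v where uv: "u \<in> borel_measurable N" "v \<in> borel_measurable N"
    "AE x in N. Re (F x) = u x" "AE x in N. Im (F x) = v x"
    using completion_ex_borel_measurable_real by metis
  show ?thesis
  proof
    show "(\<lambda>x. Complex (u x) (v x)) \<in> borel_measurable N"
      using uv(1,2) unfolding Complex_eq by measurable
    show "AE x in N. F x = Complex (u x) (v x)"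
      using uv(3,4) by eventually_elim (simp add: complex_eq_iff)
  qed
qed

lemma separating_completion:
  assumes "separating N C" shows "separating (completion N) C"
  unfolding separating_def
proof (intro conjI allI impI)
  show "countable C" "C \<subseteq> sets (completion N)" using assms by (auto simp: separating_def)
  fix F :: "'a \<Rightarrow> complex"
  assume F: "integrable (completion N) F" and 0: "\<forall>A\<in>C. (LINT x:A|completion N. F x) = 0"
  obtain G where [measurable]: "G \<in> borel_measurable N" and FG: "AE x in N. F x = G x"
    using completion_ex_borel_measurable_complex borel_measurable_integrable[OF F] by metis
  have FG': "AE x in completion N. F x = G x" using FG by (rule AE_completion)
  have Gc: "G \<in> borel_measurable (completion N)" by (simp add: measurable_completion)
  have "integrable (completion N) G"
    by (rule integrable_cong_AE_imp[OF F Gc]) (use FG' in auto)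
  then have G: "integrable N G" by (simp add: integrable_completion)
  have "AE x in N. G x = 0"
  proof (rule separatingD[OF assms G])
    fix A assume A: "A \<in> C"
    then have [measurable]: "A \<in> sets N" using assms by (auto simp: separating_def)
    have "(LINT x:A|N. G x) = (LINT x:A|completion N. G x)"
      unfolding set_lebesgue_integral_def by (subst integral_completion) auto
    also have "\<dots> = (LINT x:A|completion N. F x)"
      using FG' borel_measurable_integrable[OF F] Gc by (intro set_lebesgue_integral_cong_AE) auto
    finally show "(LINT x:A|N. G x) = 0" using 0 A by simp
  qed
  then have "AE x in N. F x = 0" using FG by eventually_elim simp
  then show "AE x in completion N. F x = 0" by (rule AE_completion)
qed

lemma separating_restrict_space:
  assumes C: "separating N C" and W: "W \<in> sets N"
  shows "separating (restrict_space N W) ((\<lambda>A. A \<inter> W) ` C)"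
  unfolding separating_def
proof (intro conjI allI impI)
  have W': "W \<inter> space N \<in> sets N" using W by auto
  show "countable ((\<lambda>A. A \<inter> W) ` C)" using C by (auto simp: separating_def)
  show "(\<lambda>A. A \<inter> W) ` C \<subseteq> sets (restrict_space N W)"
    using C W by (auto simp: separating_def sets_restrict_space_iff[OF W'])
  fix F :: "'a \<Rightarrow> complex"
  assume F: "integrable (restrict_space N W) F"
    and 0: "\<forall>A\<in>(\<lambda>A. A \<inter> W) ` C. (LINT x:A|restrict_space N W. F x) = 0"
  have "AE x in N. indicator W x *\<^sub>R F x = 0"
  proof (rule separatingD[OF C])
    show "integrable N (\<lambda>x. indicator W x *\<^sub>R F x)" using F integrable_restrict_space[OF W'] by blast
    fix A assume A: "A \<in> C"
    have "(LINT x:A|N. indicator W x *\<^sub>R F x) = (LINT x:A \<inter> W|restrict_space N W. F x)"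
      unfolding set_lebesgue_integral_def integral_restrict_space[OF W']
      by (intro Bochner_Integration.integral_cong) (auto simp: indicator_def)
    then show "(LINT x:A|N. indicator W x *\<^sub>R F x) = 0" using 0 A by auto
  qed
  then show "AE x in restrict_space N W. F x = 0"
    unfolding AE_restrict_space_iff[OF W'] by eventually_elim (auto simp: indicator_def)
qed

lemma separating_conull:
  assumes A: "A \<in> null_sets N" and C: "separating (restrict_space N (space N - A)) C"
  shows "separating N C"
  unfolding separating_def
proof (intro conjI allI impI)
  have W: "(space N - A) \<inter> space N \<in> sets N" using A by auto
  show "countable C" using C by (auto simp: separating_def)
  have C': "B \<in> sets N" "B \<subseteq> space N - A" if "B \<in> C" for B
    using separating_sets[OF C that] by (auto simp: sets_restrict_space_iff[OF W])
  then show "C \<subseteq> sets N" by blast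
  fix F :: "'a \<Rightarrow> complex"
  assume F: "integrable N F" and 0: "\<forall>B\<in>C. (LINT x:B|N. F x) = 0"
  have "AE x in restrict_space N (space N - A). F x = 0"
  proof (rule separatingD[OF C])
    show "integrable (restrict_space N (space N - A)) F"
      unfolding integrable_restrict_space[OF W] using F A by (intro integrable_mult_indicator) auto
    fix B assume B: "B \<in> C"
    have "(LINT x:B|restrict_space N (space N - A). F x) = (LINT x:B|N. F x)"
      unfolding set_lebesgue_integral_def integral_restrict_space[OF W]
      using C'[OF B] by (intro Bochner_Integration.integral_cong) (auto simp: indicator_def)
    then show "(LINT x:B|restrict_space N (space N - A). F x) = 0" using 0 B by simp
  qed
  then have "AE x in N. x \<in> space N - A \<longrightarrow> F x = 0"
    unfolding AE_restrict_space_iff[OF W] .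
  with AE_not_in[OF A] AE_space show "AE x in N. F x = 0" by eventually_elim auto
qed

text \<open>Integrals of \<open>F\<close> over preimages are integrals of \<open>F \<circ> g\<close> over the given sets. So \<open>F \<circ> g\<close> vanishes
almost everywhere, and then so does \<open>F = F \<circ> g \<circ> f\<close>.\<close>

lemma separating_isomorphic:
  fixes M' :: "'a measure" and N' :: "'b measure"
  assumes C: "separating N' C" and f: "f \<in> M' \<rightarrow>\<^sub>M N'" and g: "g \<in> N' \<rightarrow>\<^sub>M M'"
    and gf: "\<And>x. x \<in> space M' \<Longrightarrow> g (f x) = x" and d: "distr M' N' f = N'"
  shows "separating M' ((\<lambda>A. f -` A \<inter> space M') ` C)"
  unfolding separating_def
proof (intro conjI allI impI)
  note [measurable] = f g
  show "countable ((\<lambda>A. f -` A \<inter> space M') ` C)" using C by (auto simp: separating_def)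
  show "(\<lambda>A. f -` A \<inter> space M') ` C \<subseteq> sets M'"
    using separating_sets[OF C] by (auto intro: measurable_sets[OF f])
  fix F :: "'a \<Rightarrow> complex"
  assume F: "integrable M' F"
    and 0: "\<forall>A\<in>(\<lambda>A. f -` A \<inter> space M') ` C. (LINT x:A|M'. F x) = 0"
  have [measurable]: "F \<in> borel_measurable M'" using F by auto
  have ae: "AE y in N'. F (g y) = 0"
  proof (rule separatingD[OF C])
    have "integrable M' (\<lambda>x. F (g (f x)))"
      using F by (rule Bochner_Integration.integrable_cong[THEN iffD1, rotated -1]) (auto simp: gf)
    then have "integrable (distr M' N' f) (\<lambda>y. F (g y))"
      by (subst integrable_distr_eq) auto
    then show "integrable N' (\<lambda>y. F (g y))" by (simp add: d)
    fix A assume A: "A \<in> C"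
    then have [measurable]: "A \<in> sets N'" using separating_sets[OF C] by blast
    have "(LINT y:A|distr M' N' f. F (g y)) = (LINT x:f -` A \<inter> space M'|M'. F x)"
      unfolding set_lebesgue_integral_def
      by (subst integral_distr) (auto intro!: Bochner_Integration.integral_cong simp: gf indicator_def)
    then show "(LINT y:A|N'. F (g y)) = 0" using 0 A by (simp add: d)
  qed
  have "{y \<in> space N'. F (g y) = 0} \<in> sets N'" by measurable
  then have "AE x in M'. F (g (f x)) = 0"
    using ae by (subst (asm) d[symmetric], subst AE_distr_iff[symmetric]) (auto simp: f)
  with AE_space show "AE x in M'. F x = 0" by eventually_elim (simp add: gf)
qed

lemma lebesgue_probability_space_separating:
  assumes "lebesgue_probability_space M"
  obtains C where "separating M C"
proof -
  obtain N :: "real measure" where N: "prob_space N" "sets N = sets borel" "isomorphic_mod_0 M (completion N)"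
    using assms unfolding lebesgue_probability_space_def by blast
  obtain A B f g where A: "A \<in> null_sets M" and B: "B \<in> null_sets (completion N)"
    and f: "f \<in> restrict_space M (space M - A) \<rightarrow>\<^sub>M restrict_space (completion N) (space (completion N) - B)"
    and g: "g \<in> restrict_space (completion N) (space (completion N) - B) \<rightarrow>\<^sub>M restrict_space M (space M - A)"
    and gf: "\<forall>x\<in>space M - A. g (f x) = x"
    and d: "distr (restrict_space M (space M - A)) (restrict_space (completion N) (space (completion N) - B)) f =
          restrict_space (completion N) (space (completion N) - B)"
    using N(3) unfolding isomorphic_mod_0_def by blast
  interpret prob_space N by fact
  obtain C where "separating N C"
    using exists_separating_borel sigma_finite_measure_axioms N(2) by blast
  then have C: "separating (restrict_space (completion N) (space (completion N) - B))
      ((\<lambda>A. A \<inter> (space (completion N) - B)) ` C)"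
    using B by (intro separating_restrict_space separating_completion) auto
  show ?thesis
    by (rule that, rule separating_conull[OF A], rule separating_isomorphic[OF C f g _ d])
      (use gf in \<open>auto simp: space_restrict_space\<close>)
qed

text \<open>For fixed \<open>B\<close>, the function of \<open>x\<close> given by integrating \<open>F (x, _)\<close> over \<open>B\<close> is zero almost everywhere,
by separation in the first factor. There are only countably many \<open>B\<close>, so almost every slice
\<open>F (x, _)\<close> satisfies the hypothesis of separation in the second factor.\<close>

lemma separating_pair:
  assumes "sigma_finite_measure M1" "sigma_finite_measure M2"
    and C: "separating M1 C" and D: "separating M2 D"
  shows "separating (M1 \<Otimes>\<^sub>M M2) ((\<lambda>(A, B). A \<times> B) ` (C \<times> D))"
  unfolding separating_def
proof (intro conjI allI impI)
  interpret M1: sigma_finite_measure M1 by fact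
  interpret M2: sigma_finite_measure M2 by fact
  interpret pair_sigma_finite M1 M2 ..
  show "countable ((\<lambda>(A, B). A \<times> B) ` (C \<times> D))"
    using C D by (auto simp: separating_def)
  show "(\<lambda>(A, B). A \<times> B) ` (C \<times> D) \<subseteq> sets (M1 \<Otimes>\<^sub>M M2)"
    using C D by (auto simp: separating_def)
  fix F :: "'a \<times> 'b \<Rightarrow> complex"
  assume F: "integrable (M1 \<Otimes>\<^sub>M M2) F"
    and 0: "\<forall>A\<in>(\<lambda>(A, B). A \<times> B) ` (C \<times> D). (LINT x:A|M1 \<Otimes>\<^sub>M M2. F x) = 0"
  have [measurable]: "F \<in> borel_measurable (M1 \<Otimes>\<^sub>M M2)" using F by auto
  have slice: "AE x in M1. (LINT y:B|M2. F (x, y)) = 0" if B: "B \<in> D" for B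
  proof (rule separatingD[OF C])
    have [measurable]: "B \<in> sets M2" using B D by (auto simp: separating_def)
    have FB: "integrable (M1 \<Otimes>\<^sub>M M2) (\<lambda>z. indicator (space M1 \<times> B) z *\<^sub>R F z)"
      using F by (intro integrable_mult_indicator) auto
    from integrable_fst'[OF FB]
    show "integrable M1 (\<lambda>x. LINT y:B|M2. F (x, y))"
      unfolding set_lebesgue_integral_def
      by (rule Bochner_Integration.integrable_cong[THEN iffD1, rotated -1])
        (auto simp: indicator_def)
    fix A assume A: "A \<in> C"
    then have [measurable]: "A \<in> sets M1" using C by (auto simp: separating_def)
    have FAB: "integrable (M1 \<Otimes>\<^sub>M M2) (\<lambda>z. indicator (A \<times> B) z *\<^sub>R F z)"
      using F by (intro integrable_mult_indicator) auto
    have "(LINT x:A|M1. LINT y:B|M2. F (x, y)) = (LINT x|M1. LINT y|M2. indicator (A \<times> B) (x, y) *\<^sub>R F (x, y))"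
      unfolding set_lebesgue_integral_def
      by (intro Bochner_Integration.integral_cong) (auto simp: indicator_def)
    also have "\<dots> = (LINT z:A \<times> B|M1 \<Otimes>\<^sub>M M2. F z)"
      unfolding set_lebesgue_integral_def using integral_fst'[OF FAB] by simp
    finally show "(LINT x:A|M1. LINT y:B|M2. F (x, y)) = 0" using 0 A B by auto
  qed
  have "AE x in M1. \<forall>B\<in>D. (LINT y:B|M2. F (x, y)) = 0"
    using slice separating_countable[OF D] by (simp add: AE_ball_countable)
  with AE_integrable_fst'[OF F] have "AE x in M1. AE y in M2. F (x, y) = 0"
    by eventually_elim (rule separatingD[OF D], auto)
  moreover have "{z \<in> space (M1 \<Otimes>\<^sub>M M2). F z = 0} \<in> sets (M1 \<Otimes>\<^sub>M M2)" by measurable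
  ultimately show "AE z in M1 \<Otimes>\<^sub>M M2. F z = 0" by (intro AE_pair_measure)
qed

text \<open>Bessel's inequality by induction on the index set: the projections are subtracted one at a time.
The residual keeps the inner products of \<open>H\<close> with everything orthogonal to the functions already
treated, which is what makes the next projection coefficient that of \<open>H\<close> itself.\<close>

lemma bessel_residual:
  assumes "finite I" "\<And>i. i \<in> I \<Longrightarrow> F i \<in> L2 N" "\<And>i. i \<in> I \<Longrightarrow> L2_norm_sq N (F i) \<noteq> 0"
    and "\<And>i j. i \<in> I \<Longrightarrow> j \<in> I \<Longrightarrow> i \<noteq> j \<Longrightarrow> L2_inner N (F i) (F j) = 0"
    and "H \<in> L2 N"
  shows "\<exists>H' \<in> L2 N. L2_norm_sq N H' = L2_norm_sq N H - (\<Sum>i\<in>I. (cmod (L2_inner N H (F i)))\<^sup>2 / L2_norm_sq N (F i)) \<and>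
    (\<forall>G \<in> L2 N. (\<forall>i\<in>I. L2_inner N (F i) G = 0) \<longrightarrow> L2_inner N H' G = L2_inner N H G)"
  using assms
proof (induction I)
  case empty
  then show ?case by auto
next
  case (insert j I)
  then obtain H' where H': "H' \<in> L2 N"
    "L2_norm_sq N H' = L2_norm_sq N H - (\<Sum>i\<in>I. (cmod (L2_inner N H (F i)))\<^sup>2 / L2_norm_sq N (F i))"
    and orth: "\<And>G. G \<in> L2 N \<Longrightarrow> (\<forall>i\<in>I. L2_inner N (F i) G = 0) \<Longrightarrow> L2_inner N H' G = L2_inner N H G"
    by auto
  have Fj: "F j \<in> L2 N" "L2_norm_sq N (F j) \<noteq> 0" using insert by auto
  have eq: "L2_inner N H' (F j) = L2_inner N H (F j)"
    by (rule orth) (use insert in auto)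
  define c where "c = L2_inner N H' (F j) / of_real (L2_norm_sq N (F j))"
  have cF: "(\<lambda>x. c * F j x) \<in> L2 N" using Fj by (intro L2_scale)
  show ?case
  proof (intro bexI[of _ "\<lambda>x. H' x - c * F j x"] conjI ballI impI)
    show "(\<lambda>x. H' x - c * F j x) \<in> L2 N" by (intro L2_diff H' cF)
    show "L2_norm_sq N (\<lambda>x. H' x - c * F j x) =
      L2_norm_sq N H - (\<Sum>i\<in>insert j I. (cmod (L2_inner N H (F i)))\<^sup>2 / L2_norm_sq N (F i))"
      unfolding c_def L2_norm_sq_subtract_projection[OF Fj(1) H'(1) Fj(2)] unfolding H'(2) eq
      using insert.hyps by simp
    fix G assume G: "G \<in> L2 N" "\<forall>i\<in>insert j I. L2_inner N (F i) G = 0"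
    then show "L2_inner N (\<lambda>x. H' x - c * F j x) G = L2_inner N H G"
      using orth[OF G(1)] by (simp add: L2_inner_diff_left[OF H'(1) cF G(1)] L2_inner_scale_left)
  qed
qed

text \<open>A summable family of nonnegative reals has countable support.\<close>

lemma bessel_countable:
  assumes F: "\<And>i. i \<in> I \<Longrightarrow> F i \<in> L2 N" "\<And>i. i \<in> I \<Longrightarrow> \<not> (AE x in N. F i x = 0)"
    and orth: "\<And>i j. i \<in> I \<Longrightarrow> j \<in> I \<Longrightarrow> i \<noteq> j \<Longrightarrow> L2_inner N (F i) (F j) = 0"
    and H: "H \<in> L2 N"
  shows "countable {i \<in> I. L2_inner N H (F i) \<noteq> 0}"
proof -
  have nz: "L2_norm_sq N (F i) \<noteq> 0" if "i \<in> I" for i using F L2_norm_sq_eq_0_iff that by blast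
  let ?g = "\<lambda>i. (cmod (L2_inner N H (F i)))\<^sup>2 / L2_norm_sq N (F i)"
  have "?g summable_on I"
  proof (rule nonneg_bdd_above_summable_on)
    show "0 \<le> ?g i" for i using L2_norm_sq_nonneg[of N "F i"] by simp
    have "sum ?g J \<le> L2_norm_sq N H" if J: "J \<subseteq> I" "finite J" for J
    proof -
      have "\<exists>H'. L2_norm_sq N H' = L2_norm_sq N H - sum ?g J"
        using bessel_residual[of J F N H, OF J(2) F(1) nz orth H] J(1) by blast
      then obtain H' where "L2_norm_sq N H' = L2_norm_sq N H - sum ?g J" by blast
      then show ?thesis using L2_norm_sq_nonneg[of N H'] by simp
    qed
    then show "bdd_above (sum ?g ` {J. J \<subseteq> I \<and> finite J})"
      by (auto simp: bdd_above_def)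
  qed
  then have "countable {i \<in> I. ?g i \<noteq> 0}" by (rule summable_countable_real)
  moreover have "{i \<in> I. L2_inner N H (F i) \<noteq> 0} \<subseteq> {i \<in> I. ?g i \<noteq> 0}" using nz by auto
  ultimately show ?thesis by (rule countable_subset[rotated])
qed

text \<open>Every member of the system has nonzero inner product with the indicator of some set in the
separating family, and each indicator serves only countably many members.\<close>

lemma countable_orthogonal_family:
  assumes C: "separating N C" and N: "finite_measure N"
    and F: "\<And>i. i \<in> I \<Longrightarrow> F i \<in> L2 N" "\<And>i. i \<in> I \<Longrightarrow> \<not> (AE x in N. F i x = 0)"
    and orth: "\<And>i j. i \<in> I \<Longrightarrow> j \<in> I \<Longrightarrow> i \<noteq> j \<Longrightarrow> L2_inner N (F i) (F j) = 0"
  shows "countable I"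
proof -
  let ?H = "\<lambda>A x. indicator A x :: complex"
  have "countable (\<Union>A\<in>C. {i \<in> I. L2_inner N (?H A) (F i) \<noteq> 0})"
  proof (rule countable_UN[OF separating_countable[OF C]])
    fix A assume "A \<in> C"
    then have HA: "?H A \<in> L2 N"
      using separating_sets[OF C] by (intro L2_bounded[OF N, where B = 1]) (auto simp: indicator_def)
    show "countable {i \<in> I. L2_inner N (?H A) (F i) \<noteq> 0}"
      by (rule bessel_countable[OF F orth HA])
  qed
  moreover have "I \<subseteq> (\<Union>A\<in>C. {i \<in> I. L2_inner N (?H A) (F i) \<noteq> 0})"
  proof
    fix i assume i: "i \<in> I"
    have "\<exists>A\<in>C. (LINT x:A|N. F i x) \<noteq> 0"
      using separatingD[OF C L2_integrable[OF N F(1)[OF i]]] F(2)[OF i] by blast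
    then obtain A where A: "A \<in> C" "(LINT x:A|N. F i x) \<noteq> 0" by blast
    have "L2_inner N (F i) (?H A) = (LINT x:A|N. F i x)"
      unfolding L2_inner_def set_lebesgue_integral_def
      by (intro Bochner_Integration.integral_cong) (auto simp: indicator_def)
    then have "L2_inner N (?H A) (F i) \<noteq> 0" using A(2) by (subst L2_inner_commute) simp
    with i A(1) show "i \<in> (\<Union>A\<in>C. {i \<in> I. L2_inner N (?H A) (F i) \<noteq> 0})" by blast
  qed
  ultimately show ?thesis by (rule countable_subset[rotated])
qed

section \<open>Lines and characters of the plane\<close>

lemma line_eq_span:
  assumes "L \<in> lines"
  obtains a where "a \<noteq> 0" "L = span {a}"
proof -
  have L: "subspace L" "dim L = 1" using assms by (auto simp: lines_def)
  obtain B where B: "B \<subseteq> L" "independent B" "L \<subseteq> span B" "card B = dim L"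
    using basis_exists by blast
  obtain a where a: "B = {a}" using B(4) L(2) by (auto simp: card_Suc_eq)
  have "L = span {a}" using B L(1) a span_minimal[of B L] by auto
  moreover have "a \<noteq> 0" using B(2) a by simp
  ultimately show ?thesis using that by blast
qed

lemma zero_in_line: "L \<in> lines \<Longrightarrow> 0 \<in> L"
  by (auto simp: lines_def subspace_0)

text \<open>Two different lines span the plane, so frequencies prescribed on them are the restrictions of a
single frequency of the plane.\<close>

lemma distinct_lines_complement:
  assumes "L \<in> lines" "L' \<in> lines" "L \<noteq> L'"
  shows "\<exists>s\<in>L. \<exists>s'\<in>L'. t = s + s'"
    and "\<exists>v. (\<forall>s\<in>L. v \<bullet> s = l \<bullet> s) \<and> (\<forall>s\<in>L'. v \<bullet> s = l' \<bullet> s)"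
proof -
  obtain a where a: "a \<noteq> 0" "L = span {a}" using line_eq_span assms(1) by blast
  obtain b where b: "b \<noteq> 0" "L' = span {b}" using line_eq_span assms(2) by blast
  have nb: "a \<notin> span {b}"
  proof
    assume "a \<in> span {b}"
    then have "L \<subseteq> L'" unfolding a b by (intro span_minimal) auto
    then have "L = L'" using assms(1,2) by (intro subspace_dim_equal) (auto simp: lines_def)
    then show False using assms(3) by simp
  qed
  have ind: "independent {a, b}" using nb b by (auto simp: independent_insert)
  have ab: "a \<noteq> b" using nb by (auto intro: span_base)
  have "dim {a, b} = DIM(real^2)" using dim_eq_card_independent[OF ind] ab by simp
  then have "span {a, b} = UNIV" using dim_eq_full by blast
  then have "t \<in> span {a, b}" by simp
  then obtain k where "t - k *\<^sub>R a \<in> span {b}" using span_breakdown_eq by blast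
  moreover have "k *\<^sub>R a \<in> L" unfolding a by (intro span_mul span_base) simp
  ultimately show "\<exists>s\<in>L. \<exists>s'\<in>L'. t = s + s'"
    unfolding b by (intro bexI[of _ "k *\<^sub>R a"] bexI[of _ "t - k *\<^sub>R a"]) auto
  obtain g :: "real^2 \<Rightarrow> real" where g: "linear g" "g a = l \<bullet> a" "g b = l' \<bullet> b"
    using linear_independent_extend[OF ind, of "\<lambda>x. if x = a then l \<bullet> a else l' \<bullet> b"] ab by auto
  \<comment> \<open>The vector representing the linear functional \<open>g\<close>.\<close>
  define v where "v = adjoint g 1"
  have v: "v \<bullet> x = g x" for x using adjoint_works[OF g(1), of x 1] by (simp add: v_def inner_commute)
  show "\<exists>v. (\<forall>s\<in>L. v \<bullet> s = l \<bullet> s) \<and> (\<forall>s\<in>L'. v \<bullet> s = l' \<bullet> s)"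
    by (rule exI[of _ v]) (auto simp: a b v span_singleton linear_scale[OF g(1)] g(2,3))
qed

lemma norm_character_R2 [simp]: "cmod (character_R2 l t) = 1"
  by (simp add: character_R2_def)

lemma character_R2_add: "character_R2 l (s + t) = character_R2 l s * character_R2 l t"
  by (simp add: character_R2_def cis_mult inner_add_right distrib_left)

lemma character_R2_0 [simp]: "character_R2 0 t = 1" "character_R2 l 0 = 1"
  by (simp_all add: character_R2_def)

lemma character_R2_cnj [simp]: "character_R2 l t * cnj (character_R2 l t) = 1"
  "cnj (character_R2 l t) * character_R2 l t = 1"
  using complex_norm_square[of "character_R2 l t"] by (auto simp: mult.commute)

lemma measurable_character_R2 [measurable]: "character_R2 v \<in> borel_measurable borel"
  unfolding character_R2_def by (intro borel_measurable_continuous_onI continuous_intros)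

section \<open>Eigenfunctions along lines\<close>

text \<open>The part of an action of the plane that concerns single group elements. Besides actions of the plane
it covers the flow on a unit suspension.\<close>

locale plane_action = prob_space N for N :: "'a measure" +
  fixes T :: "real^2 \<Rightarrow> 'a \<Rightarrow> 'a"
  assumes T_measurable [measurable]: "\<And>t. T t \<in> N \<rightarrow>\<^sub>M N"
    and T_distr: "\<And>t. distr N N (T t) = N"
    and T_zero: "\<And>x. x \<in> space N \<Longrightarrow> T 0 x = x"
    and T_add: "\<And>s t x. x \<in> space N \<Longrightarrow> T (s + t) x = T s (T t x)"
begin

lemma AE_comp: "AE x in N. P x \<Longrightarrow> AE x in N. P (T t x)"
  by (rule AE_distrD[OF T_measurable]) (unfold T_distr)

lemma integral_comp:
  fixes F :: "'a \<Rightarrow> 'b :: {banach, second_countable_topology}"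
  assumes "F \<in> borel_measurable N"
  shows "(LINT x|N. F (T t x)) = (LINT x|N. F x)"
  using integral_distr[OF T_measurable assms, of t] by (simp add: T_distr)

lemma L2_comp: "F \<in> L2 N \<Longrightarrow> (\<lambda>x. F (T t x)) \<in> L2 N"
  by (rule L2_measure_preserving[OF T_measurable T_distr])

lemma L2_inner_comp:
  assumes "F \<in> L2 N" "H \<in> L2 N"
  shows "L2_inner N (\<lambda>x. F (T t x)) (\<lambda>x. H (T t x)) = L2_inner N F H"
  unfolding L2_inner_def using L2_inner_integrable[OF assms] by (intro integral_comp) auto

lemma L2_norm_sq_comp: "F \<in> L2 N \<Longrightarrow> L2_norm_sq N (\<lambda>x. F (T t x)) = L2_norm_sq N F"
  unfolding L2_norm_sq_def by (intro integral_comp) (auto simp: L2_def)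

lemma L2_inner_comp_left:
  assumes "F \<in> L2 N" "H \<in> L2 N"
  shows "L2_inner N (\<lambda>x. F (T t x)) H = L2_inner N F (\<lambda>x. H (T (- t) x))"
proof -
  have inv: "T (- t) (T t x) = x" if "x \<in> space N" for x
    using T_add[OF that, of "- t" t] T_zero[OF that] by simp
  have "L2_inner N (\<lambda>x. F (T t x)) H = L2_inner N (\<lambda>x. F (T t x)) (\<lambda>x. H (T (- t) (T t x)))"
    unfolding L2_inner_def by (intro Bochner_Integration.integral_cong) (auto simp: inv)
  also have "\<dots> = L2_inner N F (\<lambda>x. H (T (- t) x))" by (rule L2_inner_comp[OF assms(1) L2_comp[OF assms(2)]])
  finally show ?thesis .
qed

definition eigen_along :: "(real^2) set \<Rightarrow> real^2 \<Rightarrow> ('a \<Rightarrow> complex) \<Rightarrow> bool" where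
  "eigen_along L l F \<longleftrightarrow> (\<forall>t\<in>L. AE x in N. F (T t x) = character_R2 l t * F x)"

lemma joint_eigen:
  assumes L: "L \<in> lines" "L' \<in> lines" "L \<noteq> L'" and G: "eigen_along L l G" "eigen_along L' l' G"
    and v: "\<forall>s\<in>L. v \<bullet> s = l \<bullet> s" "\<forall>s\<in>L'. v \<bullet> s = l' \<bullet> s"
  shows "eigen_along UNIV v G"
  unfolding eigen_along_def
proof
  fix t
  obtain s s' where s: "s \<in> L" "s' \<in> L'" "t = s + s'"
    using distinct_lines_complement(1)[OF L] by blast
  have vs: "character_R2 v s = character_R2 l s" "character_R2 v s' = character_R2 l' s'"
    using v s by (simp_all add: character_R2_def)
  have "AE x in N. G (T s (T s' x)) = character_R2 l s * G (T s' x)"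
    using G(1) s(1) by (intro AE_comp) (auto simp: eigen_along_def)
  moreover have "AE x in N. G (T s' x) = character_R2 l' s' * G x"
    using G(2) s(2) by (auto simp: eigen_along_def)
  ultimately show "AE x in N. G (T t x) = character_R2 v t * G x"
    using AE_space by eventually_elim (simp add: s(3) T_add character_R2_add vs)
qed

text \<open>The projection argument from the introduction. The subspace \<open>V\<close> is the orthogonal complement of the
family \<open>\<H>\<close>, and \<open>v\<close> is the common frequency.\<close>

lemma eigenfunctions_orthogonal:
  assumes L: "L \<in> lines" "L' \<in> lines" "L \<noteq> L'"
    and \<H>: "\<H> \<subseteq> L2 N" "\<And>D t. D \<in> \<H> \<Longrightarrow> (\<lambda>x. D (T t x)) \<in> \<H>"
    and F: "F \<in> L2 N" "eigen_along L l F" "\<And>D. D \<in> \<H> \<Longrightarrow> L2_inner N F D = 0"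
    and F': "F' \<in> L2 N" "eigen_along L' l' F'"
    and v: "\<forall>s\<in>L. v \<bullet> s = l \<bullet> s" "\<forall>s\<in>L'. v \<bullet> s = l' \<bullet> s"
    and none: "\<And>G. G \<in> L2 N \<Longrightarrow> (\<And>D. D \<in> \<H> \<Longrightarrow> L2_inner N G D = 0) \<Longrightarrow> eigen_along UNIV v G \<Longrightarrow> AE x in N. G x = 0"
  shows "L2_inner N F F' = 0"
proof -
  \<comment> \<open>The candidates for the projection of \<open>F\<close>; the last condition is satisfied by the projection
    because \<open>F'\<close> lies in the space projected to.\<close>
  define K where "K = {H \<in> L2 N. (\<forall>D\<in>\<H>. L2_inner N H D = 0) \<and> eigen_along L l H \<and> L2_inner N H F' = L2_inner N F F'}"
  have KL: "K \<subseteq> L2 N" by (auto simp: K_def)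
  have FK: "F \<in> K" using F by (auto simp: K_def)
  have mid: "(\<lambda>x. (P x + Q x) / 2) \<in> K" if PQ: "P \<in> K" "Q \<in> K" for P Q
  proof -
    have P: "P \<in> L2 N" and Q: "Q \<in> L2 N" using PQ KL by auto
    have ip2: "L2_inner N (\<lambda>x. (P x + Q x) / 2) D = (L2_inner N P D + L2_inner N Q D) / 2" if "D \<in> L2 N" for D
      using L2_inner_scale_left[of N "1/2" "\<lambda>x. P x + Q x" D] L2_inner_add_left[OF P Q that] by simp
    have "eigen_along L l (\<lambda>x. (P x + Q x) / 2)"
      unfolding eigen_along_def
    proof
      fix t assume "t \<in> L"
      then have "AE x in N. P (T t x) = character_R2 l t * P x" "AE x in N. Q (T t x) = character_R2 l t * Q x"
        using PQ by (auto simp: K_def eigen_along_def)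
      then show "AE x in N. (P (T t x) + Q (T t x)) / 2 = character_R2 l t * ((P x + Q x) / 2)"
        by eventually_elim (simp add: distrib_left)
    qed
    moreover have "(\<lambda>x. (P x + Q x) / 2) \<in> L2 N" using L2_scale[OF L2_add[OF P Q], of "1/2"] by simp
    ultimately show ?thesis using PQ \<H>(1) F'(1) by (auto simp: K_def ip2 subset_eq)
  qed
  have closed: "G \<in> K"
    if f: "\<And>n. f n \<in> K" and G: "G \<in> L2 N" and lim: "(\<lambda>n. L2_norm_sq N (\<lambda>x. G x - f n x)) \<longlonglongrightarrow> 0"
      and ae: "AE x in N. (\<lambda>n. f n x) \<longlonglongrightarrow> G x" for f G
  proof -
    have fL: "f n \<in> L2 N" for n using f KL by auto
    have ipG: "L2_inner N G D = c" if "D \<in> L2 N" "\<And>n. L2_inner N (f n) D = c" for D c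
      using L2_inner_tendsto[OF fL G that(1) lim] LIMSEQ_unique by (simp add: that(2) LIMSEQ_const_iff)
    have "eigen_along L l G"
      unfolding eigen_along_def
    proof
      fix t assume t: "t \<in> L"
      have "AE x in N. \<forall>n. f n (T t x) = character_R2 l t * f n x"
        using f t by (simp add: AE_all_countable K_def eigen_along_def)
      with ae AE_comp[OF ae, of t] show "AE x in N. G (T t x) = character_R2 l t * G x"
      proof eventually_elim
        case (elim x)
        have "(\<lambda>n. f n (T t x)) \<longlonglongrightarrow> character_R2 l t * G x"
          using tendsto_mult_left[OF elim(1), of "character_R2 l t"] elim(3) by simp
        with elim(2) show ?case by (rule LIMSEQ_unique)
      qed
    qed
    moreover have "L2_inner N G D = 0" if "D \<in> \<H>" for D
      by (rule ipG) (use that f \<H>(1) in \<open>auto simp: K_def\<close>)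
    moreover have "L2_inner N G F' = L2_inner N F F'"
      by (rule ipG) (use f F'(1) in \<open>auto simp: K_def\<close>)
    ultimately show ?thesis using G by (simp add: K_def)
  qed
  have "K \<noteq> {}" using FK by blast
  obtain G where GK: "G \<in> K" and unique: "\<forall>H\<in>K. L2_norm_sq N H \<le> L2_norm_sq N G \<longrightarrow> (AE x in N. H x = G x)"
    using minimal_norm_element[OF prob_space_axioms KL \<open>K \<noteq> {}\<close> mid closed] by (rule bexE)
  have GL: "G \<in> L2 N" and GD: "\<And>D. D \<in> \<H> \<Longrightarrow> L2_inner N G D = 0" and Ge: "eigen_along L l G" and GF: "L2_inner N G F' = L2_inner N F F'"
    using GK by (auto simp: K_def)
  have "eigen_along L' l' G"
    unfolding eigen_along_def
  proof
    fix t assume t: "t \<in> L'"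
    let ?c = "character_R2 l' t"
    let ?U = "\<lambda>x. cnj ?c * G (T t x)"
    have GT: "(\<lambda>x. G (T t x)) \<in> L2 N" by (rule L2_comp[OF GL])
    \<comment> \<open>The inner product with \<open>F'\<close> is preserved because \<open>F'\<close> is itself fixed by this unitary operator.\<close>
    have "?U \<in> K"
      unfolding K_def
    proof (intro CollectI conjI ballI)
      show "?U \<in> L2 N" by (rule L2_scale[OF GT])
      show "L2_inner N ?U D = 0" if "D \<in> \<H>" for D
        using \<H> that by (auto simp: L2_inner_scale_left L2_inner_comp_left[OF GL] GD)
      show "eigen_along L l ?U"
        unfolding eigen_along_def
      proof
        fix s assume s: "s \<in> L"
        have "AE x in N. G (T s (T t x)) = character_R2 l s * G (T t x)"
          using Ge s by (intro AE_comp) (auto simp: eigen_along_def)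
        with AE_space show "AE x in N. cnj ?c * G (T t (T s x)) = character_R2 l s * (cnj ?c * G (T t x))"
        proof eventually_elim
          case (elim x)
          have "T t (T s x) = T s (T t x)"
            using T_add[OF elim(1), of t s] T_add[OF elim(1), of s t] by (simp add: add.commute)
          with elim(2) show ?case by simp
        qed
      qed
      have F'T: "AE x in N. F' (T t x) = ?c * F' x" using F'(2) t by (auto simp: eigen_along_def)
      have "L2_inner N ?U F' = cnj ?c * L2_inner N (\<lambda>x. G (T t x)) F'" by (rule L2_inner_scale_left)
      also have "\<dots> = cnj (L2_inner N (\<lambda>x. ?c * F' x) (\<lambda>x. G (T t x)))"
        by (simp add: L2_inner_scale_left L2_inner_commute[symmetric])
      also have "\<dots> = cnj (L2_inner N (\<lambda>x. F' (T t x)) (\<lambda>x. G (T t x)))"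
        using F'T by (subst L2_inner_cong_AE[OF _ L2_scale[OF F'(1)] L2_comp[OF F'(1)] GT]) auto
      also have "\<dots> = L2_inner N G F'" by (simp add: L2_inner_comp[OF F'(1) GL] L2_inner_commute[symmetric])
      finally show "L2_inner N ?U F' = L2_inner N F F'" using GF by simp
    qed
    moreover have "L2_norm_sq N ?U \<le> L2_norm_sq N G" by (simp add: L2_norm_sq_scale L2_norm_sq_comp[OF GL])
    ultimately have "AE x in N. cnj ?c * G (T t x) = G x" using unique by blast
    then show "AE x in N. G (T t x) = ?c * G x"
    proof eventually_elim
      case (elim x)
      have "?c * G x = (?c * cnj ?c) * G (T t x)" by (simp only: elim[symmetric] mult.assoc)
      then show ?case by simp
    qed
  qed
  then have "eigen_along UNIV v G" by (rule joint_eigen[OF L Ge _ v])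
  from none[OF GL GD this] have "AE x in N. G x = 0" .
  then have "L2_inner N G F' = L2_inner N (\<lambda>x. 0 * G x) F'"
    using GL by (intro L2_inner_cong_AE L2_scale F'(1)) auto
  also have "\<dots> = 0" by (simp add: L2_inner_def)
  finally show ?thesis using GF by simp
qed

text \<open>Choose one eigenfunction for each exceptional line. The set \<open>\<Lambda>\<close> of admitted frequencies has to
contain the common frequency of two lines; this holds for the two choices of \<open>\<Lambda>\<close> considered.\<close>

theorem countable_eigendirections:
  assumes C: "separating N C"
    and \<H>: "\<H> \<subseteq> L2 N" "\<And>D t. D \<in> \<H> \<Longrightarrow> (\<lambda>x. D (T t x)) \<in> \<H>"
    and \<Lambda>: "\<Lambda> = {0} \<or> \<Lambda> = UNIV"
    and none: "\<And>v G. v \<in> \<Lambda> \<Longrightarrow> G \<in> L2 N \<Longrightarrow> (\<And>D. D \<in> \<H> \<Longrightarrow> L2_inner N G D = 0) \<Longrightarrow> eigen_along UNIV v G \<Longrightarrow> AE x in N. G x = 0"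
  shows "countable {L \<in> lines. \<exists>l\<in>\<Lambda>. \<exists>F\<in>L2 N. (\<forall>D\<in>\<H>. L2_inner N F D = 0) \<and> eigen_along L l F \<and> \<not> (AE x in N. F x = 0)}"
    (is "countable ?I")
proof -
  let ?P = "\<lambda>L l F. l \<in> \<Lambda> \<and> F \<in> L2 N \<and> (\<forall>D\<in>\<H>. L2_inner N F D = 0) \<and> eigen_along L l F \<and> \<not> (AE x in N. F x = 0)"
  have "\<forall>L\<in>?I. \<exists>q. ?P L (fst q) (snd q)" by auto
  then obtain q where q: "\<forall>L\<in>?I. ?P L (fst (q L)) (snd (q L))" by (rule bchoice[elim_format]) blast
  define l where "l L = fst (q L)" for L
  define F where "F L = snd (q L)" for L
  have *: "\<And>L. L \<in> ?I \<Longrightarrow> l L \<in> \<Lambda>" "\<And>L. L \<in> ?I \<Longrightarrow> F L \<in> L2 N"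
    "\<And>L D. L \<in> ?I \<Longrightarrow> D \<in> \<H> \<Longrightarrow> L2_inner N (F L) D = 0" "\<And>L. L \<in> ?I \<Longrightarrow> eigen_along L (l L) (F L)"
    "\<And>L. L \<in> ?I \<Longrightarrow> \<not> (AE x in N. F L x = 0)"
    using q unfolding l_def F_def by blast+
  show ?thesis
  proof (rule countable_orthogonal_family[OF C finite_measure_axioms *(2,5)])
    fix L L' assume L: "L \<in> ?I" "L' \<in> ?I" "L \<noteq> L'"
    have "\<exists>v\<in>\<Lambda>. (\<forall>s\<in>L. v \<bullet> s = l L \<bullet> s) \<and> (\<forall>s\<in>L'. v \<bullet> s = l L' \<bullet> s)"
      using \<Lambda>
    proof
      assume "\<Lambda> = {0}"
      then show ?thesis using *(1)[OF L(1)] *(1)[OF L(2)] by simp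
    next
      assume "\<Lambda> = UNIV"
      then show ?thesis using distinct_lines_complement(2)[of L L' "l L" "l L'"] L by auto
    qed
    then obtain v where v: "v \<in> \<Lambda>" "\<forall>s\<in>L. v \<bullet> s = l L \<bullet> s" "\<forall>s\<in>L'. v \<bullet> s = l L' \<bullet> s" by blast
    show "L2_inner N (F L) (F L') = 0"
      by (rule eigenfunctions_orthogonal[OF _ _ L(3) \<H> *(2)[OF L(1)] *(4)[OF L(1)] *(3)[OF L(1)]
            *(2)[OF L(2)] *(4)[OF L(2)] v(2,3) none[OF v(1)]]) (use L in auto)
  qed
qed

end

section \<open>Directions of an action of the plane\<close>

lemma eigenfunction_iff_eigen_along:
  assumes "plane_action M T"
  shows "eigenfunction M T L (character_R2 l) F \<longleftrightarrow> F \<in> L2 M \<and> \<not> (AE x in M. F x = 0) \<and> plane_action.eigen_along M T L l F"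
  unfolding eigenfunction_def plane_action.eigen_along_def[OF assms] ..

text \<open>If the mean is not zero then comparing the integrals of \<open>F (T t x)\<close> and \<open>F x\<close> forces the character to
be trivial on \<open>L\<close>, and constants are invariant.\<close>

lemma (in plane_action) eigen_along_subtract_mean:
  assumes F: "F \<in> L2 N" "eigen_along L l F"
  shows "eigen_along L l (\<lambda>x. F x - (LINT y|N. F y))"
  unfolding eigen_along_def
proof
  fix t assume t: "t \<in> L"
  let ?m = "LINT y|N. F y"
  have [measurable]: "F \<in> borel_measurable N" by (rule L2_measurable[OF F(1)])
  have ae: "AE x in N. F (T t x) = character_R2 l t * F x" using F t by (auto simp: eigen_along_def)
  have "?m = (LINT x|N. F (T t x))" by (rule integral_comp[symmetric]) simp
  also have "\<dots> = (LINT x|N. character_R2 l t * F x)" using ae by (intro integral_cong_AE) auto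
  also have "\<dots> = character_R2 l t * ?m" by simp
  finally have m: "character_R2 l t * ?m = ?m" by simp
  show "AE x in N. F (T t x) - ?m = character_R2 l t * (F x - ?m)"
    using ae by eventually_elim (simp add: right_diff_distrib m)
qed

lemma plane_action_R2:
  assumes "R2_action M T" shows "plane_action M T"
proof -
  have "prob_space M" using assms by (auto simp: free_mp_action_def lebesgue_probability_space_def)
  then show ?thesis
    using assms by (auto simp: plane_action_def plane_action_axioms_def free_mp_action_def)
qed

text \<open>Here the subspace \<open>V\<close> consists of the functions of mean zero. A non-constant eigenfunction minus its
mean is a nonzero eigenfunction in \<open>V\<close>, and a constant in \<open>V\<close> is zero.\<close>

lemma countable_directions_R2:
  assumes T: "R2_action M T" and \<Lambda>: "\<Lambda> = {0} \<or> \<Lambda> = UNIV"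
    and wm: "weak_mixing_on M T UNIV (character_R2 ` \<Lambda>)"
  shows "countable {L \<in> lines. \<not> weak_mixing_on M T L (character_R2 ` (L \<inter> \<Lambda>))}"
proof -
  interpret plane_action M T by (rule plane_action_R2[OF T])
  obtain C where C: "separating M C"
    using lebesgue_probability_space_separating T by (auto simp: free_mp_action_def)
  define \<H> where "\<H> = {\<lambda>_ :: 'a. 1 :: complex}"
  have \<H>: "\<H> \<subseteq> L2 M" "\<And>D t. D \<in> \<H> \<Longrightarrow> (\<lambda>x. D (T t x)) \<in> \<H>"
    using L2_bounded[OF finite_measure_axioms, where F = "\<lambda>_. 1" and B = 1] by (auto simp: \<H>_def)
  have ip1: "L2_inner M G (\<lambda>_. 1) = (LINT x|M. G x)" for G by (simp add: L2_inner_def)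
  have none: "AE x in M. G x = 0"
    if v: "v \<in> \<Lambda>" and G: "G \<in> L2 M" and orth: "\<And>D. D \<in> \<H> \<Longrightarrow> L2_inner M G D = 0" and eig: "eigen_along UNIV v G" for v G
  proof (rule ccontr)
    assume nz: "\<not> (AE x in M. G x = 0)"
    then have "eigenfunction M T UNIV (character_R2 v) G"
      using G eig by (simp add: eigenfunction_iff_eigen_along[OF plane_action_axioms])
    then obtain c where c: "AE x in M. G x = c"
      using wm v unfolding weak_mixing_on_def by blast
    have "(LINT x|M. G x) = (LINT x|M. c)"
      using c L2_measurable[OF G] by (intro integral_cong_AE) auto
    also have "\<dots> = c" by (simp add: prob_space)
    finally have "c = 0" using orth[of "\<lambda>_. 1"] by (simp add: \<H>_def ip1)
    then show False using c nz by simp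
  qed
  show ?thesis
  proof (rule countable_subset[OF _ countable_eigendirections[OF C \<H> \<Lambda> none]], safe)
    fix L assume L: "L \<in> lines" "\<not> weak_mixing_on M T L (character_R2 ` (L \<inter> \<Lambda>))"
    then obtain l F where lF: "l \<in> \<Lambda>" "eigenfunction M T L (character_R2 l) F"
      and nc: "\<not> (\<exists>c. AE x in M. F x = c)"
      unfolding weak_mixing_on_def by blast
    then have F: "F \<in> L2 M" "eigen_along L l F" by (simp_all add: eigenfunction_iff_eigen_along[OF plane_action_axioms])
    let ?m = "LINT y|M. F y"
    let ?G = "\<lambda>x. F x - ?m"
    have G: "?G \<in> L2 M"
      by (intro L2_diff F L2_bounded[OF finite_measure_axioms, where B = "cmod ?m"]) auto
    have "(LINT x|M. ?G x) = 0"
      using L2_integrable[OF finite_measure_axioms F(1)] by (simp add: prob_space)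
    then have "\<forall>D\<in>\<H>. L2_inner M ?G D = 0" by (simp add: \<H>_def ip1)
    moreover have "\<not> (AE x in M. ?G x = 0)" using nc by auto
    ultimately show "\<exists>l\<in>\<Lambda>. \<exists>F\<in>L2 M. (\<forall>D\<in>\<H>. L2_inner M F D = 0) \<and> eigen_along L l F \<and> \<not> (AE x in M. F x = 0)"
      using lF(1) G eigen_along_subtract_mean[OF F] by blast
  qed
qed

section \<open>The unit square as a torus\<close>

abbreviation int_vec :: "int^2 \<Rightarrow> real^2" where
  "int_vec k \<equiv> (\<chi> i. of_int (k $ i))"

abbreviation floor_vec :: "real^2 \<Rightarrow> int^2" where
  "floor_vec r \<equiv> (\<chi> i. \<lfloor>r $ i\<rfloor>)"

abbreviation frac_vec :: "real^2 \<Rightarrow> real^2" where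
  "frac_vec r \<equiv> (\<chi> i. frac (r $ i))"

lemma suspension_eq: "suspension S t = (\<lambda>(x, r). (S (floor_vec (t + r)) x, frac_vec (t + r)))"
  by (simp add: suspension_def)

lemma frac_vec_in_unit_square: "frac_vec r \<in> unit_square"
  by (simp add: unit_square_def frac_lt_1)

lemma unit_square_frac_floor:
  assumes "r \<in> unit_square"
  shows "frac_vec r = r" "floor_vec r = 0"
  using assms by (auto simp: unit_square_def vec_eq_iff frac_eq floor_eq_iff)

lemma frac_vec_eq: "frac_vec r = r - int_vec (floor_vec r)"
  by (simp add: vec_eq_iff frac_def)

lemma floor_vec_eq_iff: "floor_vec r = k \<longleftrightarrow> r - int_vec k \<in> unit_square"
  by (auto simp: vec_eq_iff unit_square_def floor_eq_iff algebra_simps)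

lemma sets_unit_square [measurable]: "unit_square \<in> sets borel"
proof -
  have "unit_square = {r. 0 \<le> r $ 1} \<inter> {r. 0 \<le> r $ 2} \<inter> {r. r $ 1 < 1} \<inter> {r. r $ 2 < 1}"
    unfolding unit_square_def forall_2 by auto
  also have "\<dots> \<in> sets borel"
    by (intro sets.Int borel_closed borel_open closed_halfspace_component_ge_cart open_halfspace_component_lt_cart)
  finally show ?thesis .
qed

lemma measurable_floor_vec [measurable]: "floor_vec \<in> borel \<rightarrow>\<^sub>M count_space UNIV"
  unfolding measurable_count_space_eq2_countable
proof (intro conjI ballI)
  fix k :: "int^2"
  have "floor_vec -` {k} \<inter> space borel = (\<lambda>r. r - int_vec k) -` unit_square \<inter> space borel"
    using floor_vec_eq_iff[of _ k] by blast
  also have "\<dots> \<in> sets borel" by (rule measurable_sets[of _ borel borel]) measurable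
  finally show "floor_vec -` {k} \<inter> space borel \<in> sets borel" .
qed simp

lemma measurable_frac_vec [measurable]: "frac_vec \<in> borel \<rightarrow>\<^sub>M borel"
  unfolding frac_vec_eq
  by (rule measurable_compose_countable[where f = "\<lambda>k r. r - int_vec k"]) measurable

lemma space_unit_square_measure [simp]: "space unit_square_measure = unit_square"
  by (simp add: unit_square_measure_def space_restrict_space)

lemma measurable_into_unit_square:
  assumes "f \<in> M \<rightarrow>\<^sub>M borel" "\<And>x. x \<in> space M \<Longrightarrow> f x \<in> unit_square"
  shows "f \<in> M \<rightarrow>\<^sub>M unit_square_measure"
  unfolding unit_square_measure_def using assms by (intro measurable_restrict_space2) auto

lemma measurable_frac_vec_unit_square [measurable]: "frac_vec \<in> borel \<rightarrow>\<^sub>M unit_square_measure"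
  by (rule measurable_into_unit_square) (auto simp: frac_vec_in_unit_square)

lemma measurable_from_unit_square [measurable]: "(\<lambda>r. r) \<in> unit_square_measure \<rightarrow>\<^sub>M borel"
  unfolding unit_square_measure_def by (rule measurable_restrict_space1) simp

lemma nn_integral_unit_square:
  "(\<integral>\<^sup>+r. g r \<partial>unit_square_measure) = (\<integral>\<^sup>+r. g r * indicator unit_square r \<partial>lborel)"
  unfolding unit_square_measure_def by (rule nn_integral_restrict_space) simp

lemma prob_space_unit_square: "prob_space unit_square_measure"
proof
  have one: "(1 :: real^2) \<bullet> b = 1" if "b \<in> Basis" for b
    using that by (auto simp: Basis_vec_def inner_axis)
  have "box 0 1 \<subseteq> unit_square" "unit_square \<subseteq> cbox 0 (1 :: real^2)"
    by (auto simp: unit_square_def mem_box_cart less_imp_le)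
  then have "emeasure lborel (box 0 (1 :: real^2)) \<le> emeasure lborel unit_square"
    "emeasure lborel unit_square \<le> emeasure lborel (cbox 0 (1 :: real^2))"
    by (auto intro!: emeasure_mono)
  moreover have "emeasure lborel (box 0 (1 :: real^2)) = 1" "emeasure lborel (cbox 0 (1 :: real^2)) = 1"
    by (simp_all add: one)
  ultimately have "emeasure lborel unit_square = 1" by (metis antisym)
  then show "emeasure unit_square_measure (space unit_square_measure) = 1"
    by (simp add: unit_square_measure_def emeasure_restrict_space)
qed

lemma nn_integral_lborel_translate:
  fixes f :: "'b :: euclidean_space \<Rightarrow> ennreal"
  assumes "f \<in> borel_measurable borel"
  shows "(\<integral>\<^sup>+r. f (c + r) \<partial>lborel) = (\<integral>\<^sup>+r. f r \<partial>lborel)"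
  using assms by (subst (2) lborel_distr_plus[of c, symmetric]) (simp add: nn_integral_distr)

lemma nn_integral_count_space_single:
  fixes f :: "'b \<Rightarrow> ennreal"
  assumes "\<And>k. k \<noteq> k0 \<Longrightarrow> f k = 0"
  shows "(\<integral>\<^sup>+k. f k \<partial>count_space UNIV) = f k0"
  using nn_integral_count_space'[of "{k0}" UNIV f] assms by auto

text \<open>A translation of the torus preserves Lebesgue measure on the square. Extend \<open>g\<close> to a periodic
function on the plane and cut the translated square into pieces along the lattice translates of the
unit square. Translating each piece back and summing over the lattice recovers the unit square,
because exactly one lattice translate of a given point lies in it.\<close>

lemma nn_integral_unit_square_rotate:
  assumes g: "g \<in> borel_measurable unit_square_measure"
  shows "(\<integral>\<^sup>+r. g (frac_vec (t + r)) \<partial>unit_square_measure) = (\<integral>\<^sup>+r. g r \<partial>unit_square_measure)"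
proof -
  \<comment> \<open>The periodic extension of \<open>g\<close>.\<close>
  define h where "h r = g (frac_vec r)" for r
  have [measurable]: "h \<in> borel_measurable borel"
    unfolding h_def by (rule measurable_compose[OF measurable_frac_vec_unit_square g])
  let ?I = "indicator unit_square :: real^2 \<Rightarrow> ennreal"
  have hQ: "h r * ?I r = g r * ?I r" for r
    by (auto simp: h_def indicator_def unit_square_frac_floor)
  have hp: "h (r + int_vec k) = h r" for r k
    unfolding h_def by (simp add: frac_def)
  have "(\<integral>\<^sup>+r. g (frac_vec (t + r)) \<partial>unit_square_measure) = (\<integral>\<^sup>+r. h (t + r) * ?I r \<partial>lborel)"
    by (simp add: nn_integral_unit_square h_def)
  also have "\<dots> = (\<integral>\<^sup>+r. (\<integral>\<^sup>+k. h (t + r) * ?I r * ?I (t + r - int_vec k) \<partial>count_space UNIV) \<partial>lborel)"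
  proof (intro nn_integral_cong)
    fix r
    have "(\<integral>\<^sup>+k. h (t + r) * ?I r * ?I (t + r - int_vec k) \<partial>count_space UNIV)
      = h (t + r) * ?I r * ?I (t + r - int_vec (floor_vec (t + r)))"
      by (rule nn_integral_count_space_single)
        (auto simp: indicator_def simp flip: floor_vec_eq_iff)
    also have "t + r - int_vec (floor_vec (t + r)) \<in> unit_square"
      by (rule floor_vec_eq_iff[THEN iffD1, OF refl])
    then have "?I (t + r - int_vec (floor_vec (t + r))) = 1" by simp
    finally show "h (t + r) * ?I r = (\<integral>\<^sup>+k. h (t + r) * ?I r * ?I (t + r - int_vec k) \<partial>count_space UNIV)"
      by simp
  qed
  also have "\<dots> = (\<integral>\<^sup>+k. (\<integral>\<^sup>+r. h (t + r) * ?I r * ?I (t + r - int_vec k) \<partial>lborel) \<partial>count_space UNIV)"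
    by (rule nn_integral_count_space_nn_integral) (auto intro: countableI_type)
  also have "\<dots> = (\<integral>\<^sup>+k. (\<integral>\<^sup>+r. h r * ?I r * ?I (r - t + int_vec k) \<partial>lborel) \<partial>count_space UNIV)"
  proof (rule nn_integral_cong)
    fix k
    let ?f = "\<lambda>r. h r * ?I r * ?I (r - t + int_vec k)"
    have "(\<integral>\<^sup>+r. ?f r \<partial>lborel) = (\<integral>\<^sup>+r. ?f ((t - int_vec k) + r) \<partial>lborel)"
      by (rule nn_integral_lborel_translate[symmetric]) measurable
    also have "\<dots> = (\<integral>\<^sup>+r. h (t + r) * ?I r * ?I (t + r - int_vec k) \<partial>lborel)"
    proof (intro nn_integral_cong)
      fix r
      have "h (t - int_vec k + r) = h (t + r)"
        using hp[of "t - int_vec k + r" k] by (simp add: algebra_simps)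
      then show "?f (t - int_vec k + r) = h (t + r) * ?I r * ?I (t + r - int_vec k)"
        by (simp add: algebra_simps)
    qed
    finally show "(\<integral>\<^sup>+r. h (t + r) * ?I r * ?I (t + r - int_vec k) \<partial>lborel) = (\<integral>\<^sup>+r. ?f r \<partial>lborel)" ..
  qed
  also have "\<dots> = (\<integral>\<^sup>+r. (\<integral>\<^sup>+k. h r * ?I r * ?I (r - t + int_vec k) \<partial>count_space UNIV) \<partial>lborel)"
    by (rule nn_integral_count_space_nn_integral[symmetric]) (auto intro: countableI_type)
  also have "\<dots> = (\<integral>\<^sup>+r. h r * ?I r \<partial>lborel)"
  proof (intro nn_integral_cong)
    fix r
    have inQ: "r - t + int_vec k \<in> unit_square \<longleftrightarrow> k = - floor_vec (r - t)" for k
    proof -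
      have "r - t + int_vec k = r - t - int_vec (- k)" by (simp add: vec_eq_iff)
      then have "r - t + int_vec k \<in> unit_square \<longleftrightarrow> floor_vec (r - t) = - k"
        by (simp only: floor_vec_eq_iff)
      then show ?thesis by (metis minus_minus)
    qed
    have "(\<integral>\<^sup>+k. h r * ?I r * ?I (r - t + int_vec k) \<partial>count_space UNIV)
      = h r * ?I r * ?I (r - t + int_vec (- floor_vec (r - t)))"
      by (rule nn_integral_count_space_single) (simp only: indicator_def inQ if_False mult_zero_right of_bool_eq)
    also have "?I (r - t + int_vec (- floor_vec (r - t))) = 1"
      by (simp only: indicator_def inQ of_bool_eq simp_thms)
    finally show "(\<integral>\<^sup>+k. h r * ?I r * ?I (r - t + int_vec k) \<partial>count_space UNIV) = h r * ?I r" by simp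
  qed
  also have "\<dots> = (\<integral>\<^sup>+r. g r \<partial>unit_square_measure)"
    by (simp add: nn_integral_unit_square hQ)
  finally show ?thesis .
qed

section \<open>The unit suspension\<close>

locale lattice_action = prob_space M for M :: "'a measure" +
  fixes S :: "int^2 \<Rightarrow> 'a \<Rightarrow> 'a"
  assumes S_measurable [measurable]: "\<And>n. S n \<in> M \<rightarrow>\<^sub>M M"
    and S_distr: "\<And>n. distr M M (S n) = M"
    and S_zero: "\<And>x. x \<in> space M \<Longrightarrow> S 0 x = x"
    and S_add: "\<And>m n x. x \<in> space M \<Longrightarrow> S (m + n) x = S m (S n x)"
begin

sublocale square: prob_space unit_square_measure by (rule prob_space_unit_square)
sublocale prod: pair_prob_space M unit_square_measure ..

lemma suspension_measurable [measurable]: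
  "suspension S t \<in> M \<Otimes>\<^sub>M unit_square_measure \<rightarrow>\<^sub>M M \<Otimes>\<^sub>M unit_square_measure"
proof -
  have [measurable]: "snd \<in> M \<Otimes>\<^sub>M unit_square_measure \<rightarrow>\<^sub>M borel"
    by (rule measurable_compose[OF measurable_snd measurable_from_unit_square])
  have shift: "(\<lambda>z. t + snd z) \<in> M \<Otimes>\<^sub>M unit_square_measure \<rightarrow>\<^sub>M borel" by measurable
  have "(\<lambda>z. S (floor_vec (t + snd z)) (fst z)) \<in> M \<Otimes>\<^sub>M unit_square_measure \<rightarrow>\<^sub>M M"
    by (rule measurable_compose_countable[where f = "\<lambda>k z. S k (fst z)", OF _ measurable_compose[OF shift measurable_floor_vec]])
      measurable
  moreover have "(\<lambda>z. frac_vec (t + snd z)) \<in> M \<Otimes>\<^sub>M unit_square_measure \<rightarrow>\<^sub>M unit_square_measure"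
    by (rule measurable_compose[OF _ measurable_frac_vec_unit_square]) measurable
  ultimately show ?thesis
    unfolding suspension_eq case_prod_beta by (rule measurable_Pair)
qed

lemma nn_integral_S: "f \<in> borel_measurable M \<Longrightarrow> (\<integral>\<^sup>+x. f (S n x) \<partial>M) = (\<integral>\<^sup>+x. f x \<partial>M)"
  by (subst (2) S_distr[of n, symmetric]) (simp add: nn_integral_distr)

text \<open>On each fibre over the square the suspension acts by an element of the lattice, which preserves
\<open>M\<close>; on the base it is a rotation of the torus.\<close>

lemma suspension_distr:
  "distr (M \<Otimes>\<^sub>M unit_square_measure) (M \<Otimes>\<^sub>M unit_square_measure) (suspension S t) = M \<Otimes>\<^sub>M unit_square_measure"
  (is "distr ?P ?P _ = ?P")
proof (rule measure_eqI)
  fix A assume "A \<in> sets (distr ?P ?P (suspension S t))"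
  then have A [measurable]: "A \<in> sets ?P" by simp
  have slice: "(\<lambda>x. indicator A (x, r) :: ennreal) \<in> borel_measurable M" if "r \<in> unit_square" for r
    by (rule measurable_compose[OF measurable_Pair2'[of r unit_square_measure M]]) (use that in \<open>auto simp: A\<close>)
  define g where "g r = (\<integral>\<^sup>+x. indicator A (x, r) \<partial>M)" for r
  have g: "g \<in> borel_measurable unit_square_measure" unfolding g_def by measurable
  have "emeasure (distr ?P ?P (suspension S t)) A = (\<integral>\<^sup>+z. indicator A z \<partial>distr ?P ?P (suspension S t))"
    by simp
  also have "\<dots> = (\<integral>\<^sup>+z. indicator A (suspension S t z) \<partial>?P)"
    by (rule nn_integral_distr) measurable
  also have "\<dots> = (\<integral>\<^sup>+r. \<integral>\<^sup>+x. indicator A (suspension S t (x, r)) \<partial>M \<partial>unit_square_measure)"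
    by (rule prod.nn_integral_snd[symmetric]) measurable
  also have "\<dots> = (\<integral>\<^sup>+r. g (frac_vec (t + r)) \<partial>unit_square_measure)"
    unfolding suspension_eq g_def prod.case
    by (intro nn_integral_cong nn_integral_S slice frac_vec_in_unit_square)
  also have "\<dots> = (\<integral>\<^sup>+r. g r \<partial>unit_square_measure)" by (rule nn_integral_unit_square_rotate[OF g])
  also have "\<dots> = (\<integral>\<^sup>+z. indicator A z \<partial>?P)" unfolding g_def by (rule prod.nn_integral_snd) measurable
  finally show "emeasure (distr ?P ?P (suspension S t)) A = emeasure ?P A" by simp
qed simp

lemma suspension_add:
  assumes "x \<in> space M"
  shows "suspension S (s + t) (x, r) = suspension S s (suspension S t (x, r))"
proof -
  have "\<lfloor>s $ i + (t $ i + r $ i)\<rfloor> = \<lfloor>s $ i + frac (t $ i + r $ i)\<rfloor> + \<lfloor>t $ i + r $ i\<rfloor>" for i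
  proof -
    have "s $ i + (t $ i + r $ i) = s $ i + frac (t $ i + r $ i) + of_int \<lfloor>t $ i + r $ i\<rfloor>"
      by (simp add: frac_def)
    then show ?thesis by (metis floor_add_int)
  qed
  then have fl: "floor_vec (s + t + r) = floor_vec (s + frac_vec (t + r)) + floor_vec (t + r)"
    by (simp add: vec_eq_iff add.assoc)
  have fr: "frac_vec (s + t + r) = frac_vec (s + frac_vec (t + r))"
    unfolding frac_vec_eq[of "s + t + r"] frac_vec_eq[of "s + frac_vec (t + r)"] fl
    by (simp add: vec_eq_iff frac_def)
  show ?thesis unfolding suspension_eq prod.case fl fr by (simp only: S_add[OF assms])
qed

lemma suspension_zero:
  assumes "x \<in> space M" "t + r \<in> unit_square"
  shows "suspension S t (x, r) = (x, t + r)"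
  using assms unfolding suspension_eq by (simp only: prod.case unit_square_frac_floor S_zero)

lemma suspension_int_vec:
  assumes "r \<in> unit_square"
  shows "suspension S (int_vec n) (x, r) = (S n x, r)"
proof -
  have "floor_vec (int_vec n + r) = n" unfolding floor_vec_eq_iff using assms by simp
  moreover have "frac_vec (int_vec n + r) = r" unfolding frac_vec_eq using calculation by (simp only: add_diff_cancel_left')
  ultimately show ?thesis by (simp only: suspension_eq prod.case)
qed

sublocale susp: plane_action "suspension_measure M" "suspension S"
proof -
  interpret c: prob_space "completion (M \<Otimes>\<^sub>M unit_square_measure)"
  proof
    show "emeasure (completion (M \<Otimes>\<^sub>M unit_square_measure)) (space (completion (M \<Otimes>\<^sub>M unit_square_measure))) = 1"
      using prod.emeasure_space_1 by simp
  qed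
  show "plane_action (suspension_measure M) (suspension S)"
    unfolding suspension_measure_def
  proof
    fix t
    show "suspension S t \<in> completion (M \<Otimes>\<^sub>M unit_square_measure) \<rightarrow>\<^sub>M completion (M \<Otimes>\<^sub>M unit_square_measure)"
      "distr (completion (M \<Otimes>\<^sub>M unit_square_measure)) (completion (M \<Otimes>\<^sub>M unit_square_measure)) (suspension S t)
        = completion (M \<Otimes>\<^sub>M unit_square_measure)"
      by (rule measure_preserving_completion[OF suspension_measurable suspension_distr])+
  next
    fix z assume "z \<in> space (completion (M \<Otimes>\<^sub>M unit_square_measure))"
    then obtain x r where z: "z = (x, r)" "x \<in> space M" "r \<in> unit_square" by (auto simp: space_pair_measure)
    show "suspension S 0 z = z" using suspension_zero[of x 0 r] z by simp
    show "suspension S (s + t) z = suspension S s (suspension S t z)" for s t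
      using suspension_add z by simp
  qed
qed

lemma AE_suspension_measure:
  "(AE z in suspension_measure M. P z) \<longleftrightarrow> (AE z in M \<Otimes>\<^sub>M unit_square_measure. P z)"
  unfolding suspension_measure_def by (rule AE_completion_iff)

lemma square_function_L2:
  assumes "f \<in> L2 unit_square_measure" shows "(\<lambda>(x, s). f s) \<in> L2 (suspension_measure M)"
proof -
  have "distr (M \<Otimes>\<^sub>M unit_square_measure) unit_square_measure snd = unit_square_measure"
  proof (rule measure_eqI)
    fix B assume "B \<in> sets (distr (M \<Otimes>\<^sub>M unit_square_measure) unit_square_measure snd)"
    then have [measurable]: "B \<in> sets unit_square_measure" by simp
    have "snd -` B \<inter> space (M \<Otimes>\<^sub>M unit_square_measure) = space M \<times> B"
      using sets.sets_into_space[of B unit_square_measure] by (auto simp: space_pair_measure)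
    then show "emeasure (distr (M \<Otimes>\<^sub>M unit_square_measure) unit_square_measure snd) B = emeasure unit_square_measure B"
      by (simp add: emeasure_distr square.emeasure_pair_measure_Times emeasure_space_1)
  qed simp
  from L2_measure_preserving[OF measurable_snd this assms] show ?thesis
    unfolding suspension_measure_def case_prod_unfold by (rule L2_completion)
qed

lemma square_functions_L2: "square_functions \<subseteq> L2 (suspension_measure M)"
  using square_function_L2 by (auto simp: square_functions_def)

lemma measure_preserving_rotation:
  shows "(\<lambda>r. frac_vec (t + r)) \<in> unit_square_measure \<rightarrow>\<^sub>M unit_square_measure"
    and "distr unit_square_measure unit_square_measure (\<lambda>r. frac_vec (t + r)) = unit_square_measure"
proof -
  show m [measurable]: "(\<lambda>r. frac_vec (t + r)) \<in> unit_square_measure \<rightarrow>\<^sub>M unit_square_measure"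
    by (rule measurable_compose[OF _ measurable_frac_vec_unit_square]) measurable
  show "distr unit_square_measure unit_square_measure (\<lambda>r. frac_vec (t + r)) = unit_square_measure"
  proof (rule measure_eqI)
    fix B assume "B \<in> sets (distr unit_square_measure unit_square_measure (\<lambda>r. frac_vec (t + r)))"
    then have [measurable]: "B \<in> sets unit_square_measure" by simp
    have "emeasure (distr unit_square_measure unit_square_measure (\<lambda>r. frac_vec (t + r))) B
      = (\<integral>\<^sup>+r. indicator B r \<partial>distr unit_square_measure unit_square_measure (\<lambda>r. frac_vec (t + r)))"
      by simp
    also have "\<dots> = (\<integral>\<^sup>+r. indicator B (frac_vec (t + r)) \<partial>unit_square_measure)"
      by (rule nn_integral_distr) measurable
    also have "\<dots> = (\<integral>\<^sup>+r. indicator B r \<partial>unit_square_measure)"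
      by (rule nn_integral_unit_square_rotate) measurable
    finally show "emeasure (distr unit_square_measure unit_square_measure (\<lambda>r. frac_vec (t + r))) B
      = emeasure unit_square_measure B" by simp
  qed simp
qed

lemma square_functions_invariant:
  assumes "D \<in> square_functions" shows "(\<lambda>z. D (suspension S t z)) \<in> square_functions"
proof -
  obtain f where f: "f \<in> L2 unit_square_measure" "D = (\<lambda>(x, s). f s)"
    using assms by (auto simp: square_functions_def)
  have "(\<lambda>s. f (frac_vec (t + s))) \<in> L2 unit_square_measure"
    by (rule L2_measure_preserving[OF measure_preserving_rotation f(1)])
  moreover have "(\<lambda>z. D (suspension S t z)) = (\<lambda>(x, s). f (frac_vec (t + s)))"
    by (auto simp: f(2) suspension_eq)
  ultimately show ?thesis unfolding square_functions_def by blast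
qed

end

section \<open>Eigenfunctions of the unit suspension\<close>

context lattice_action
begin

text \<open>Dividing \<open>G\<close> by the character of the square coordinate gives a function \<open>\<Gamma>\<close> that is invariant under
the flow. As long as the flow does not leave the square it only moves the square coordinate, so for
almost every pair of points \<open>r\<close>, \<open>s\<close> in the square the slices of \<open>\<Gamma>\<close> at \<open>r\<close> and \<open>s\<close> agree almost
everywhere. The slice at a generic point \<open>r0\<close> is the required function on \<open>M\<close>.\<close>

lemma suspension_eigenfunction_product:
  assumes G: "G \<in> L2 (suspension_measure M)" and eig: "susp.eigen_along UNIV v G"
  obtains g where "g \<in> L2 M"
    "AE z in M \<Otimes>\<^sub>M unit_square_measure. G z = character_R2 v (snd z) * g (fst z)"
proof -
  let ?P = "M \<Otimes>\<^sub>M unit_square_measure" and ?e = "character_R2 v"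
  let ?I = "indicator unit_square :: real^2 \<Rightarrow> ennreal"
  obtain G1 where G1 [measurable]: "G1 \<in> borel_measurable ?P" and GG1: "AE z in ?P. G z = G1 z"
    using completion_ex_borel_measurable_complex L2_measurable[OF G] unfolding suspension_measure_def by metis
  have GG1': "AE z in suspension_measure M. G z = G1 z" using GG1 by (simp only: AE_suspension_measure)
  have "G1 \<in> L2 (suspension_measure M)"
    by (rule L2_cong_AE[OF G GG1']) (simp add: suspension_measure_def measurable_completion)
  then have G1_sq: "integrable ?P (\<lambda>z. (cmod (G1 z))\<^sup>2)"
    by (simp add: L2_def suspension_measure_def integrable_completion)
  have eig1: "AE z in ?P. G1 (suspension S t z) = ?e t * G1 z" for t
  proof -
    have "AE z in suspension_measure M. G (suspension S t z) = ?e t * G z"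
      using eig by (simp add: susp.eigen_along_def)
    with GG1' susp.AE_comp[OF GG1', of t]
    have "AE z in suspension_measure M. G1 (suspension S t z) = ?e t * G1 z"
      by eventually_elim simp
    then show ?thesis by (simp only: AE_suspension_measure)
  qed
  \<comment> \<open>The periodic extension in \<open>r\<close> makes \<open>\<Gamma>\<close> a function on the whole plane, so that translation
    invariance of \<open>lborel\<close> applies; it is used at points of the square only.\<close>
  define \<Gamma> where "\<Gamma> x r = cnj (?e r) * G1 (x, frac_vec r)" for x r
  have \<Gamma>_meas: "(\<lambda>z. \<Gamma> (fst z) (snd z)) \<in> borel_measurable (M \<Otimes>\<^sub>M borel)"
  proof -
    have "(\<lambda>z. (fst z, frac_vec (snd z))) \<in> M \<Otimes>\<^sub>M borel \<rightarrow>\<^sub>M ?P"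
      by (intro measurable_Pair measurable_compose[OF measurable_snd measurable_frac_vec_unit_square]) measurable
    then have 1: "(\<lambda>z. G1 (fst z, frac_vec (snd z))) \<in> borel_measurable (M \<Otimes>\<^sub>M borel)"
      by (rule measurable_compose[OF _ G1])
    have 2: "(\<lambda>z. cnj (?e (snd z))) \<in> borel_measurable (M \<Otimes>\<^sub>M borel)"
      by (intro borel_measurable_continuous_on[OF continuous_on_cnj[OF continuous_on_id]]) measurable
    show ?thesis unfolding \<Gamma>_def using 1 2 by (rule borel_measurable_times[rotated])
  qed
  have \<Gamma>_comp [measurable (raw)]: "(\<lambda>y. \<Gamma> (f y) (k y)) \<in> borel_measurable N"
    if "f \<in> N \<rightarrow>\<^sub>M M" "k \<in> N \<rightarrow>\<^sub>M borel" for f k and N :: "'c measure"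
    using measurable_compose[OF measurable_Pair[OF that] \<Gamma>_meas] by simp
  have \<Gamma>_unit: "G1 (x, r) = ?e r * \<Gamma> x r" if "r \<in> unit_square" for x r
    using that by (simp add: \<Gamma>_def unit_square_frac_floor mult.assoc[symmetric])
  \<comment> \<open>The \<open>L1\<close> distance between the slices of \<open>\<Gamma>\<close> at \<open>r\<close> and \<open>s\<close>.\<close>
  define h where "h r s = (\<integral>\<^sup>+x. ennreal (cmod (\<Gamma> x r - \<Gamma> x s)) \<partial>M)" for r s
  have h_comp: "(\<lambda>y. h (f y) (k y)) \<in> borel_measurable N"
    if [measurable]: "f \<in> N \<rightarrow>\<^sub>M borel" "k \<in> N \<rightarrow>\<^sub>M borel" for f k and N :: "'d measure"
    unfolding h_def by measurable
  have shift: "(\<integral>\<^sup>+r. ?I (r + t) * h r (r + t) \<partial>unit_square_measure) = 0" for t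
  proof -
    have [measurable]: "snd \<in> ?P \<rightarrow>\<^sub>M borel"
      by (rule measurable_compose[OF measurable_snd measurable_from_unit_square])
    have "(\<integral>\<^sup>+r. ?I (r + t) * h r (r + t) \<partial>unit_square_measure)
      = (\<integral>\<^sup>+r. \<integral>\<^sup>+x. ?I (r + t) * ennreal (cmod (\<Gamma> x r - \<Gamma> x (r + t))) \<partial>M \<partial>unit_square_measure)"
      unfolding h_def by (intro nn_integral_cong nn_integral_cmult[symmetric]) measurable
    also have "\<dots> = (\<integral>\<^sup>+z. ?I (snd z + t) * ennreal (cmod (\<Gamma> (fst z) (snd z) - \<Gamma> (fst z) (snd z + t))) \<partial>?P)"
      by (subst prod.nn_integral_snd[symmetric]) auto
    also have "\<dots> = (\<integral>\<^sup>+z. 0 \<partial>?P)"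
    proof (rule nn_integral_cong_AE)
      show "AE z in ?P. ?I (snd z + t) * ennreal (cmod (\<Gamma> (fst z) (snd z) - \<Gamma> (fst z) (snd z + t))) = 0"
        using eig1[of t] AE_space
      proof eventually_elim
        case (elim z)
        obtain x r where z: "z = (x, r)" "x \<in> space M" "r \<in> unit_square"
          using elim(2) by (auto simp: space_pair_measure)
        have "\<Gamma> x r = \<Gamma> x (r + t)" if rt: "r + t \<in> unit_square"
        proof -
          have "?e (r + t) * \<Gamma> x (r + t) = ?e t * (?e r * \<Gamma> x r)"
            using elim(1) suspension_zero[OF z(2), of t r] rt
            by (simp add: z(1) add.commute \<Gamma>_unit[OF rt] \<Gamma>_unit[OF z(3)])
          also have "\<dots> = ?e (r + t) * \<Gamma> x r" by (simp add: character_R2_add mult_ac)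
          finally show ?thesis
            using norm_character_R2[of v "r + t"] by (metis mult_cancel_left norm_zero zero_neq_one)
        qed
        then show ?case by (simp add: z(1) indicator_def)
      qed
    qed
    finally show ?thesis by simp
  qed
  \<comment> \<open>Substituting \<open>s = r + t\<close> and exchanging the integrals reduces this to the case of a fixed
    translation \<open>t\<close>.\<close>
  have "(\<integral>\<^sup>+r. (\<integral>\<^sup>+s. ?I s * h r s \<partial>lborel) \<partial>unit_square_measure) = 0"
  proof -
    interpret pair_sigma_finite "lborel :: (real^2) measure" unit_square_measure ..
    have "(\<integral>\<^sup>+s. ?I s * h r s \<partial>lborel) = (\<integral>\<^sup>+t. ?I (r + t) * h r (r + t) \<partial>lborel)" for r
      by (rule nn_integral_lborel_translate[symmetric]) (intro borel_measurable_times_ennreal h_comp, measurable)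
    then have "(\<integral>\<^sup>+r. (\<integral>\<^sup>+s. ?I s * h r s \<partial>lborel) \<partial>unit_square_measure)
      = (\<integral>\<^sup>+r. (\<integral>\<^sup>+t. ?I (r + t) * h r (r + t) \<partial>lborel) \<partial>unit_square_measure)"
      by simp
    also have "\<dots> = (\<integral>\<^sup>+t. (\<integral>\<^sup>+r. ?I (r + t) * h r (r + t) \<partial>unit_square_measure) \<partial>lborel)"
    proof (rule Fubini'[where f = "\<lambda>t r. ?I (r + t) * h r (r + t)"])
      have [measurable]: "snd \<in> (lborel :: (real^2) measure) \<Otimes>\<^sub>M unit_square_measure \<rightarrow>\<^sub>M borel"
        by (rule measurable_compose[OF measurable_snd measurable_from_unit_square])
      show "(\<lambda>(t, r). ?I (r + t) * h r (r + t)) \<in> borel_measurable (lborel \<Otimes>\<^sub>M unit_square_measure)"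
        unfolding case_prod_unfold by (intro borel_measurable_times_ennreal h_comp) measurable
    qed
    finally show ?thesis by (simp add: shift)
  qed
  moreover have "(\<lambda>r. \<integral>\<^sup>+s. ?I s * h r s \<partial>lborel) \<in> borel_measurable unit_square_measure"
  proof -
    have [measurable]: "fst \<in> unit_square_measure \<Otimes>\<^sub>M (lborel :: (real^2) measure) \<rightarrow>\<^sub>M borel"
      by (rule measurable_compose[OF measurable_fst measurable_from_unit_square])
    have "(\<lambda>z. ?I (snd z) * h (fst z) (snd z)) \<in> borel_measurable (unit_square_measure \<Otimes>\<^sub>M lborel)"
      by (intro borel_measurable_times_ennreal h_comp) measurable
    from lborel.borel_measurable_nn_integral_fst[OF this] show ?thesis by simp
  qed
  ultimately have "AE r in unit_square_measure. (\<integral>\<^sup>+s. ?I s * h r s \<partial>lborel) = 0"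
    by (simp add: nn_integral_0_iff_AE)
  moreover have "AE r in unit_square_measure. integrable M (\<lambda>x. (cmod (G1 (x, r)))\<^sup>2)"
    by (rule prod.AE_integrable_snd) (simp add: G1_sq case_prod_unfold)
  ultimately have "AE r in unit_square_measure. r \<in> unit_square \<and> (\<integral>\<^sup>+s. ?I s * h r s \<partial>lborel) = 0 \<and>
      integrable M (\<lambda>x. (cmod (G1 (x, r)))\<^sup>2)"
    using AE_space by eventually_elim simp
  then obtain r0 where r0: "r0 \<in> unit_square" "(\<integral>\<^sup>+s. ?I s * h r0 s \<partial>lborel) = 0"
      "integrable M (\<lambda>x. (cmod (G1 (x, r0)))\<^sup>2)"
    using eventually_happens'[OF square.ae_filter_bot] by blast
  show ?thesis
  proof
    have [measurable]: "snd \<in> ?P \<rightarrow>\<^sub>M borel"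
      by (rule measurable_compose[OF measurable_snd measurable_from_unit_square])
    have "(\<lambda>x. \<Gamma> x r0) \<in> borel_measurable M" by measurable
    moreover have "(cmod (\<Gamma> x r0))\<^sup>2 = (cmod (G1 (x, r0)))\<^sup>2" for x
      by (simp add: \<Gamma>_unit[OF r0(1)] norm_mult)
    ultimately show "(\<lambda>x. \<Gamma> x r0) \<in> L2 M" using r0(3) by (simp add: L2_def)
    have "(\<integral>\<^sup>+z. ennreal (cmod (\<Gamma> (fst z) r0 - \<Gamma> (fst z) (snd z))) \<partial>?P) = (\<integral>\<^sup>+s. h r0 s \<partial>unit_square_measure)"
      unfolding h_def by (subst prod.nn_integral_snd[symmetric]) auto
    also have "\<dots> = 0" using r0(2) by (simp add: nn_integral_unit_square mult.commute)
    finally have "AE z in ?P. ennreal (cmod (\<Gamma> (fst z) r0 - \<Gamma> (fst z) (snd z))) = 0"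
      by (subst (asm) nn_integral_0_iff_AE) auto
    with GG1 AE_space show "AE z in ?P. G z = ?e (snd z) * \<Gamma> (fst z) r0"
      by eventually_elim (auto simp: space_pair_measure \<Gamma>_unit)
  qed
qed

text \<open>Integer translations do not change the square coordinate, so the factor \<open>g\<close> of the product form of
\<open>G\<close> is an eigenfunction of the lattice action, hence constant. Then \<open>G\<close> is a multiple of a function of
the square coordinate, and orthogonality makes the multiple zero.\<close>

lemma suspension_joint_eigenfunction_zero:
  assumes wm: "weak_mixing_on M S UNIV (character_Z2 ` \<Lambda>)" and v: "v \<in> \<Lambda>"
    and G: "G \<in> L2 (suspension_measure M)" and eig: "susp.eigen_along UNIV v G"
    and orth: "\<And>D. D \<in> square_functions \<Longrightarrow> L2_inner (suspension_measure M) G D = 0"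
  shows "AE z in suspension_measure M. G z = 0"
proof -
  let ?N = "suspension_measure M" and ?e = "character_R2 v"
  obtain g where g: "g \<in> L2 M" and "AE z in M \<Otimes>\<^sub>M unit_square_measure. G z = ?e (snd z) * g (fst z)"
    using suspension_eigenfunction_product[OF G eig] .
  then have Gg: "AE z in ?N. G z = ?e (snd z) * g (fst z)" by (simp only: AE_suspension_measure)
  have g_eig: "AE x in M. g (S n x) = character_Z2 v n * g x" for n
  proof -
    have "AE z in ?N. G (suspension S (int_vec n) z) = ?e (int_vec n) * G z"
      using eig by (simp add: susp.eigen_along_def)
    with Gg susp.AE_comp[OF Gg, of "int_vec n"]
    have "AE z in ?N. ?e (snd (suspension S (int_vec n) z)) * g (fst (suspension S (int_vec n) z))
        = ?e (int_vec n) * (?e (snd z) * g (fst z))"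
      by eventually_elim simp
    then have "AE z in M \<Otimes>\<^sub>M unit_square_measure. ?e (snd (suspension S (int_vec n) z)) * g (fst (suspension S (int_vec n) z))
        = ?e (int_vec n) * (?e (snd z) * g (fst z))"
      by (simp only: AE_suspension_measure)
    with AE_space have "AE z in M \<Otimes>\<^sub>M unit_square_measure. g (S n (fst z)) = character_Z2 v n * g (fst z)"
    proof eventually_elim
      case (elim z)
      obtain x r where z: "z = (x, r)" "r \<in> unit_square" using elim(1) by (auto simp: space_pair_measure)
      have "?e r * g (S n x) = ?e r * (?e (int_vec n) * g x)"
        using elim(2) by (simp add: z suspension_int_vec mult_ac)
      then have "g (S n x) = ?e (int_vec n) * g x"
        using norm_character_R2[of v r] by (metis mult_cancel_left norm_zero zero_neq_one)
      then show ?case by (simp add: z character_Z2_def)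
    qed
    from prod.AE_pair[OF this] show ?thesis by simp
  qed
  have "\<exists>c. AE x in M. g x = c"
  proof (cases "AE x in M. g x = 0")
    case False
    then have "eigenfunction M S UNIV (character_Z2 v) g" using g g_eig by (simp add: eigenfunction_def)
    then show ?thesis using wm v unfolding weak_mixing_on_def by blast
  qed blast
  then obtain c where c: "AE x in M. g x = c" by blast
  have "AE z in distr (M \<Otimes>\<^sub>M unit_square_measure) M fst. g z = c"
    unfolding square.distr_pair_fst by (rule c)
  then have "AE z in M \<Otimes>\<^sub>M unit_square_measure. g (fst z) = c" by (rule AE_distrD[OF measurable_fst])
  then have c': "AE z in ?N. g (fst z) = c" by (simp only: AE_suspension_measure)
  define D where "D = (\<lambda>(x :: 'a, s). ?e s)"
  have "?e \<in> L2 unit_square_measure"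
    by (rule L2_bounded[OF square.finite_measure_axioms, where B = 1])
      (use measurable_compose[OF measurable_from_unit_square measurable_character_R2] in auto)
  then have D: "D \<in> square_functions" unfolding D_def square_functions_def by blast
  then have DL: "D \<in> L2 ?N" using square_functions_L2 by blast
  have GD: "AE z in ?N. G z = c * D z"
    using Gg c' by eventually_elim (simp add: D_def case_prod_unfold)
  have "0 = L2_inner ?N G D" using orth[OF D] by simp
  also have "\<dots> = L2_inner ?N (\<lambda>z. c * D z) D" by (rule L2_inner_cong_AE[OF GD G L2_scale[OF DL] DL])
  also have "\<dots> = c * of_real (L2_norm_sq ?N D)" by (simp add: L2_inner_scale_left L2_inner_self)
  also have "L2_norm_sq ?N D = 1" by (simp add: L2_norm_sq_def D_def case_prod_unfold susp.prob_space)
  finally have "c = 0" by simp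
  then show ?thesis using GD by simp
qed

lemma countable_directions_suspension:
  assumes C: "separating M C" and \<Lambda>: "\<Lambda> = {0} \<or> \<Lambda> = UNIV"
    and wm: "weak_mixing_on M S UNIV (character_Z2 ` \<Lambda>)"
  shows "countable {L \<in> lines. \<exists>F\<in>L2_perp_square M. \<exists>l\<in>L \<inter> \<Lambda>.
    eigenfunction (suspension_measure M) (suspension S) L (character_R2 l) F}"
proof -
  obtain E :: "(real^2) set set" where "separating lborel E"
    using exists_separating_borel lborel.sigma_finite_measure_axioms sets_lborel by blast
  then have "separating unit_square_measure ((\<lambda>A. A \<inter> unit_square) ` E)"
    unfolding unit_square_measure_def by (rule separating_restrict_space) simp
  then have "separating (M \<Otimes>\<^sub>M unit_square_measure) ((\<lambda>(A, B). A \<times> B) ` (C \<times> ((\<lambda>A. A \<inter> unit_square) ` E)))"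
    by (rule separating_pair[OF sigma_finite_measure_axioms square.sigma_finite_measure_axioms C])
  then have sep: "separating (suspension_measure M) ((\<lambda>(A, B). A \<times> B) ` (C \<times> ((\<lambda>A. A \<inter> unit_square) ` E)))"
    unfolding suspension_measure_def by (rule separating_completion)
  show ?thesis
  proof (rule countable_subset[OF _ susp.countable_eigendirections[OF sep square_functions_L2 square_functions_invariant \<Lambda>
        suspension_joint_eigenfunction_zero[OF wm]]], safe)
    fix L F l assume "F \<in> L2_perp_square M" "l \<in> \<Lambda>"
      "eigenfunction (suspension_measure M) (suspension S) L (character_R2 l) F"
    then show "\<exists>l\<in>\<Lambda>. \<exists>F\<in>L2 (suspension_measure M). (\<forall>D\<in>square_functions. L2_inner (suspension_measure M) F D = 0) \<and>
        susp.eigen_along L l F \<and> \<not> (AE x in suspension_measure M. F x = 0)"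
      by (auto simp: eigenfunction_iff_eigen_along[OF susp.plane_action_axioms] L2_perp_square_def L2_inner_def)
  qed
qed

end

section \<open>Countability of the exceptional directions\<close>

lemma lattice_action_Z2:
  assumes "Z2_action M S" shows "lattice_action M S"
proof -
  have "prob_space M" using assms by (auto simp: free_mp_action_def lebesgue_probability_space_def)
  then show ?thesis
    using assms by (auto simp: lattice_action_def lattice_action_axioms_def free_mp_action_def)
qed

lemma countable_directions_Z2:
  assumes S: "Z2_action M S" and \<Lambda>: "\<Lambda> = {0} \<or> \<Lambda> = UNIV"
    and wm: "weak_mixing_on M S UNIV (character_Z2 ` \<Lambda>)"
  shows "countable {L \<in> lines. \<exists>F\<in>L2_perp_square M. \<exists>l\<in>L \<inter> \<Lambda>.
    eigenfunction (suspension_measure M) (suspension S) L (character_R2 l) F}"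
proof -
  obtain C where "separating M C"
    using lebesgue_probability_space_separating S by (auto simp: free_mp_action_def)
  then show ?thesis by (rule lattice_action.countable_directions_suspension[OF lattice_action_Z2[OF S] _ \<Lambda> wm])
qed

text \<open>Invariant functions are the eigenfunctions for the trivial character, apart from the zero function,
which is constant anyway.\<close>

lemma ergodic_on_iff_weak_mixing_on:
  "ergodic_on M T K \<longleftrightarrow> weak_mixing_on M T K {\<lambda>_. 1}"
proof -
  have "invariant_function M T K F \<longleftrightarrow> eigenfunction M T K (\<lambda>_. 1) F"
    if "\<not> (AE x in M. F x = 0)" for F
    using that by (auto simp: invariant_function_def eigenfunction_def)
  moreover have "\<exists>c. AE x in M. F x = c" if "AE x in M. F x = 0" for F :: "'a \<Rightarrow> complex"
    using that by blast
  ultimately show ?thesis unfolding ergodic_on_def weak_mixing_on_def by auto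
qed

theorem theorem5p1:
  fixes M :: "'a measure"
    and T :: "real^2 \<Rightarrow> 'a \<Rightarrow> 'a"
    and S :: "int^2 \<Rightarrow> 'a \<Rightarrow> 'a"
  shows
    "(R2_action M T \<and> ergodic M T \<longrightarrow> countable {L \<in> lines. \<not> ergodic_dir_R2 M T L}) \<and>
     (Z2_action M S \<and> ergodic M S \<longrightarrow> countable {L \<in> lines. \<not> ergodic_dir_Z2 M S L}) \<and>
     (R2_action M T \<and> weak_mixing_R2 M T \<longrightarrow>
        countable {L \<in> lines. \<not> weak_mixing_dir_R2 M T L}) \<and>
     (Z2_action M S \<and> weak_mixing_Z2 M S \<longrightarrow>
        countable {L \<in> lines. \<not> weak_mixing_dir_Z2 M S L})"
proof (intro conjI impI; elim conjE)
  have R0: "character_R2 ` {0} = {\<lambda>_. 1}" by (auto simp: fun_eq_iff)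
  have Z0: "character_Z2 ` {0} = {\<lambda>_. 1}" by (auto simp: fun_eq_iff character_Z2_def)
  {
    assume T: "R2_action M T" and erg: "ergodic M T"
    have "weak_mixing_on M T UNIV (character_R2 ` {0})"
      using erg unfolding R0 ergodic_def ergodic_on_iff_weak_mixing_on .
    from countable_directions_R2[OF T _ this]
    have "countable {L \<in> lines. \<not> weak_mixing_on M T L (character_R2 ` (L \<inter> {0}))}" by simp
    then show "countable {L \<in> lines. \<not> ergodic_dir_R2 M T L}"
    proof (rule countable_subset[rotated], safe)
      fix L assume "L \<in> lines" "\<not> ergodic_dir_R2 M T L"
        and "weak_mixing_on M T L (character_R2 ` (L \<inter> {0}))"
      moreover have "L \<inter> {0} = {0}" using zero_in_line[OF \<open>L \<in> lines\<close>] by auto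
      ultimately show False
        by (simp only: ergodic_dir_R2_def ergodic_on_iff_weak_mixing_on R0)
    qed
  next
    assume S: "Z2_action M S" and erg: "ergodic M S"
    have "weak_mixing_on M S UNIV (character_Z2 ` {0})"
      using erg unfolding Z0 ergodic_def ergodic_on_iff_weak_mixing_on .
    from countable_directions_Z2[OF S _ this]
    have "countable {L \<in> lines. \<exists>F\<in>L2_perp_square M. \<exists>l\<in>L \<inter> {0}.
      eigenfunction (suspension_measure M) (suspension S) L (character_R2 l) F}" by simp
    then show "countable {L \<in> lines. \<not> ergodic_dir_Z2 M S L}"
      by (rule countable_subset[rotated])
        (auto simp: ergodic_dir_Z2_def invariant_function_def eigenfunction_def dest: zero_in_line)
  next
    assume T: "R2_action M T" and wm: "weak_mixing_R2 M T"
    from countable_directions_R2[OF T _ wm[unfolded weak_mixing_R2_def]]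
    show "countable {L \<in> lines. \<not> weak_mixing_dir_R2 M T L}"
      by (simp add: weak_mixing_dir_R2_def)
  next
    assume S: "Z2_action M S" and wm: "weak_mixing_Z2 M S"
    from countable_directions_Z2[OF S _ wm[unfolded weak_mixing_Z2_def]]
    show "countable {L \<in> lines. \<not> weak_mixing_dir_Z2 M S L}"
      by (simp add: weak_mixing_dir_Z2_def)
  }
qed

end
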